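(* Let $G$ be the disjoint union of finite graphs $G_1,\dots,G_m$. For $i\in[m]$ let $t_i=\alpha(G_i)$ and $\ell_i=L(I_{t_i}(G_i))$, and let $t=\sum_{i=1}^m t_i=\alpha(G)$ and $\ell=L(I_t(G))$. Then $\ell=\sum_{i=1}^m\ell_i+m-1$.
   Context: $\alpha$ is the independence number. For a graph $G=(V,E)$, $I_n(G)=\{U\subseteq V:\ \alpha(G[U])<n\}$. $\tilde{H}_i$ denotes reduced simplicial homology with real coefficients. For a simplicial complex $X$ on vertex set $V$, $X[U]=\{\sigma\in X:\sigma\subseteq U\}$; $X$ is $d$-Leray if $\tilde{H}_i(X[U])=0$ for all $U\subseteq V$ and all $i\geq d$, and the Leray number $L(X)$ is the minimum such $d$. *)

theory Defs
  imports
    "HOL-Algebra.Elementary_Groups"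
    "HOL-Combinatorics.Permutations"
    "HOL-Library.Disjoint_Sets"
    "Graph_Theory.Graph_Theory"
begin

section \<open>Reduced simplicial homology with real coefficients\<close>

text \<open>
  An abstract simplicial complex is its set of faces, the empty face included. The vertex set is
  a separate argument where it matters, because a vertex need not be a face.

  An \<open>i\<close>-chain is a function on orderings of faces with \<open>i + 1\<close> vertices (distinct lists) that
  changes sign under odd permutations, i.e. a function on oriented simplices that is odd under
  reversal of the orientation. The index is an integer: for \<open>i = -1\<close> the only possible face
  is the empty one, and for \<open>i < -1\<close> the zero chain is the only chain. Thus the complex below is
  the augmented one.
\<close>

definition chains :: "int \<Rightarrow> 'a set set \<Rightarrow> ('a list \<Rightarrow> real) set" where
  "chains i X = {c.
     finite {xs. c xs \<noteq> 0} \<and>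
     (\<forall>xs. c xs \<noteq> 0 \<longrightarrow> distinct xs \<and> set xs \<in> X \<and> int (length xs) = i + 1) \<and>
     (\<forall>xs p. p permutes {..<length xs} \<longrightarrow>
        c (permute_list p xs) = real_of_int (sign p) * c xs)}"

text \<open>
  The usual formula \<open>\<partial>[v\<^sub>0, \<dots>, v\<^sub>k] = (\<Sum>j. (-1) ^ j * [v\<^sub>0, \<dots>, v\<^sub>j omitted, \<dots>, v\<^sub>k])\<close>, read off on
  coefficients: the oriented simplex \<open>xs\<close> occurs in \<open>\<partial>[v, xs]\<close> with coefficient \<open>1\<close>, so its
  coefficient in \<open>\<partial>c\<close> is the sum of \<open>c (v # xs)\<close> over all \<open>v\<close>. The sum is restricted to the
  support of \<open>c\<close> only to make it finite. On \<open>0\<close>-chains this is the augmentation.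
\<close>

definition boundary :: "('a list \<Rightarrow> real) \<Rightarrow> 'a list \<Rightarrow> real" where
  "boundary c = (\<lambda>xs. \<Sum>v \<in> {v. c (v # xs) \<noteq> 0}. c (v # xs))"

definition cycles :: "int \<Rightarrow> 'a set set \<Rightarrow> ('a list \<Rightarrow> real) set" where
  "cycles i X = {c \<in> chains i X. boundary c = (\<lambda>_. 0)}"

definition boundaries :: "int \<Rightarrow> 'a set set \<Rightarrow> ('a list \<Rightarrow> real) set" where
  "boundaries i X = boundary ` chains (i + 1) X"

definition cycle_group :: "int \<Rightarrow> 'a set set \<Rightarrow> ('a list \<Rightarrow> real) monoid" where
  "cycle_group i X =
     \<lparr>carrier = cycles i X, monoid.mult = (\<lambda>c d xs. c xs + d xs), monoid.one = (\<lambda>_. 0)\<rparr>"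

text \<open>Only the additive group of the real vector space is recorded.\<close>

definition reduced_homology_group ::
    "int \<Rightarrow> 'a set set \<Rightarrow> ('a list \<Rightarrow> real) set monoid" where
  "reduced_homology_group i X = cycle_group i X Mod boundaries i X"


section \<open>Leray numbers\<close>

definition induced_subcomplex :: "'a set set \<Rightarrow> 'a set \<Rightarrow> 'a set set" where
  "induced_subcomplex X U = {\<sigma> \<in> X. \<sigma> \<subseteq> U}"

definition Leray :: "int \<Rightarrow> 'a set \<Rightarrow> 'a set set \<Rightarrow> bool" where
  "Leray d V X \<longleftrightarrow>
     (\<forall>U \<subseteq> V. \<forall>i \<ge> d. trivial_group (reduced_homology_group i (induced_subcomplex X U)))"

text \<open>
  The minimum is over \<open>d \<ge> -1\<close>, the range in which reduced homology lives. If the empty set is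
  a face, then it spans the homology of the subcomplex induced on the empty set in degree \<open>-1\<close>,
  so the minimum is nonnegative and the bound is irrelevant. The bound matters only for the
  complex without any face, which is \<open>d\<close>-Leray for every \<open>d\<close> and gets the value \<open>-1\<close>.
\<close>

definition Leray_number :: "'a set \<Rightarrow> 'a set set \<Rightarrow> int" where
  "Leray_number V X = (LEAST d. d \<ge> -1 \<and> Leray d V X)"


section \<open>Independence numbers and the complexes of vertex sets of small independence number\<close>

definition independent_set :: "('a, 'b) pre_digraph \<Rightarrow> 'a set \<Rightarrow> bool" where
  "independent_set G S \<longleftrightarrow> S \<subseteq> verts G \<and> (\<forall>u \<in> S. \<forall>v \<in> S. \<not> u \<rightarrow>\<^bsub>G\<^esub> v)"

definition independence_number :: "('a, 'b) pre_digraph \<Rightarrow> nat" where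
  "independence_number G = Max {card S |S. independent_set G S}"

definition I_complex :: "nat \<Rightarrow> ('a, 'b) pre_digraph \<Rightarrow> 'a set set" where
  "I_complex n G = {U. U \<subseteq> verts G \<and> independence_number (G \<restriction> U) < n}"

end

theory Submission
  imports Defs
begin

text \<open>
  Write \<open>V\<^sub>i\<close> for the vertex set and \<open>X\<^sub>i\<close> for the complex of \<open>G\<^sub>i\<close>. Since \<open>\<alpha>\<close> is additive over
  the components, a set of vertices is a nonface of \<open>I\<^sub>t(G)\<close> iff its trace on every \<open>V\<^sub>i\<close> is a
  nonface of \<open>X\<^sub>i\<close>. The nonfaces inside \<open>U\<close> span the relative chain complex of the full simplex on
  \<open>U\<close> modulo the induced subcomplex, whose homology is the reduced homology of the subcomplex
  shifted by one degree, and for \<open>I\<^sub>t(G)\<close> this relative complex is the tensor product of those of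
  the components. The Leray number plus one is therefore the largest size of a nonface in the
  support of a relative homology class, and it has to be shown that this size is additive.

  Instead of the Kuenneth theorem, discrete Hodge theory is used: homology classes are represented by harmonic
  functions, those killed by the boundary and by its adjoint. On a join the two partial Laplacians
  are both positive semidefinite and their mixed terms cancel, so a function is harmonic iff it is
  harmonic in each factor separately.
\<close>

section \<open>The simplicial boundary on functions of vertex sets\<close>

text \<open>A set is a face as soon as one of its traces is a face, so the faces of the whole
  complex have no product description; only the nonfaces do. No basis of homology is needed, only
  the sizes of sets in supports. A product of harmonic functions shows that sums of sizes occur.
  Conversely, a slice of a harmonic function through a nonzero value shows that no other sizes
  occur. The slices are the reason for harmonic representatives: fixing one trace of a relative
  cycle need not leave a relative cycle in the other factor, whereas a harmonic function stays
  harmonic. This rests on a sum of squares being zero, which is where real coefficients enter. The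
  shift by one degree uses that the full simplex on \<open>U\<close> is acyclic. This fails for
  \<open>U = {}\<close>, which is treated separately and accounts for degree \<open>-1\<close>.
  Adding the \<open>m\<close> equations "largest size = Leray number + 1" produces the summand
  \<open>m - 1\<close>. Components without vertices and the case \<open>m = 0\<close> fit in: a
  complex without faces has largest size \<open>0\<close> and Leray number
  \<open>-1\<close>.\<close>

text \<open>
  A chain is encoded by its values on the faces listed in a fixed vertex order. Then \<open>s u v\<close> is \<open>-1\<close>
  iff \<open>u\<close> precedes \<open>v\<close>, and \<open>eps v A\<close> below is the sign of moving \<open>v\<close> from the front of \<open>A\<close> to its
  place. Keeping \<open>s\<close> abstract makes the theory symmetric in the two factors of a join.
\<close>

locale vertex_signs =
  fixes V :: "'a set" and s :: "'a \<Rightarrow> 'a \<Rightarrow> real"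
  assumes finite_V: "finite V"
    and s_sq: "s u v * s u v = 1"
    and s_swap: "\<lbrakk>u \<in> V; v \<in> V; u \<noteq> v\<rbrakk> \<Longrightarrow> s v u = - s u v"
begin

definition eps :: "'a \<Rightarrow> 'a set \<Rightarrow> real" where
  "eps v A = (\<Prod>u\<in>A. s u v)"

text \<open>The parameter \<open>W\<close> limits the vertices that may be inserted, so that on a
  join over \<open>U1 \<union> U2\<close> the boundary splits into the partial boundaries
  \<open>del U1\<close> and \<open>del U2\<close>.\<close>

definition del :: "'a set \<Rightarrow> ('a set \<Rightarrow> real) \<Rightarrow> 'a set \<Rightarrow> real" where
  "del W f A = (\<Sum>v\<in>W - A. eps v A * f (insert v A))"

text \<open>The transpose of \<open>del W\<close>, see \<open>del_cod_adjoint\<close>. For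
  \<open>W = {u}\<close> it is the cone operator with apex \<open>u\<close>.\<close>

definition cod :: "'a set \<Rightarrow> ('a set \<Rightarrow> real) \<Rightarrow> 'a set \<Rightarrow> real" where
  "cod W f A = (\<Sum>v\<in>A \<inter> W. eps v (A - {v}) * f (A - {v}))"

lemma finite_sub [simp]: "A \<subseteq> V \<Longrightarrow> finite A"
  using finite_V finite_subset by blast

lemma eps_sq: "eps v A * eps v A = 1"
  by (simp add: eps_def s_sq flip: prod.distrib)

lemma eps_sq_left: "eps v A * (eps v A * x) = x"
  by (simp add: eps_sq flip: mult.assoc)

lemma eps_nonzero: "eps v A \<noteq> 0"
  using eps_sq[of v A] by auto

lemma eps_insert: "finite A \<Longrightarrow> u \<notin> A \<Longrightarrow> eps v (insert u A) = s u v * eps v A"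
  by (simp add: eps_def)

lemma eps_Un: "finite A \<Longrightarrow> finite B \<Longrightarrow> A \<inter> B = {} \<Longrightarrow> eps v (A \<union> B) = eps v A * eps v B"
  by (simp add: eps_def prod.union_disjoint)

text \<open>The two orders of inserting \<open>u\<close> and \<open>v\<close> differ only in which
  of them is compared with the other, and \<open>s\<close> is antisymmetric.\<close>

lemma eps_swap:
  assumes "A \<subseteq> V" "u \<in> V" "v \<in> V" "u \<noteq> v" "u \<notin> A" "v \<notin> A"
  shows "eps u (insert v A) * eps v A = - (eps v (insert u A) * eps u A)"
  using assms by (simp add: eps_insert s_swap[of u v])

lemma del_diff: "del W (\<lambda>A. f A - g A) A = del W f A - del W g A"
  by (simp add: del_def algebra_simps sum_subtractf)

lemma del_Un:
  assumes "W1 \<subseteq> V" "W2 \<subseteq> V" "W1 \<inter> W2 = {}"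
  shows "del (W1 \<union> W2) f A = del W1 f A + del W2 f A"
  unfolding del_def Un_Diff using assms
  by (intro sum.union_disjoint) (auto simp: finite_subset[OF _ finite_V])

lemma cod_Un:
  assumes "W1 \<subseteq> V" "W2 \<subseteq> V" "W1 \<inter> W2 = {}"
  shows "cod (W1 \<union> W2) f A = cod W1 f A + cod W2 f A"
  unfolding cod_def Int_Un_distrib using assms
  by (intro sum.union_disjoint) (auto simp: finite_subset[OF _ finite_V])

text \<open>Disjointness of \<open>W1\<close> and \<open>W2\<close> makes the removed and the
  inserted vertex distinct, so both sides run over the same pairs; exchanging the two moves costs
  one sign.\<close>

lemma cod_del_anticommute:
  assumes "W1 \<subseteq> V" "A \<subseteq> V" "W1 \<inter> W2 = {}"
  shows "cod W2 (del W1 f) A = - del W1 (cod W2 f) A"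
proof -
  have "cod W2 (del W1 f) A =
      (\<Sum>w\<in>A \<inter> W2. \<Sum>v\<in>W1 - A. eps w (A - {w}) * (eps v (A - {w}) * f (insert v (A - {w}))))"
    unfolding cod_def del_def sum_distrib_left
    using assms by (intro sum.cong) auto
  also have "\<dots> = (\<Sum>w\<in>A \<inter> W2. \<Sum>v\<in>W1 - A.
      - (eps v A * (eps w (insert v A - {w}) * f (insert v A - {w}))))"
  proof (intro sum.cong refl)
    fix w v assume w: "w \<in> A \<inter> W2" and v: "v \<in> W1 - A"
    define B where "B = A - {w}"
    have B: "A = insert w B" "insert v A - {w} = insert v B" "w \<notin> B" "v \<notin> B" "v \<noteq> w"
      using w v assms unfolding B_def by auto
    have "w \<in> V" "v \<in> V" using w v assms(1,2) by auto
    then have "s v w = - s w v" using B(5) s_swap by blast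
    moreover have "finite B" using assms(2) by (simp add: B_def)
    ultimately have "eps w B * eps v B = - (eps v A * eps w (insert v B))"
      using B s_sq[of w v] by (simp add: eps_insert)
    then show "eps w (A - {w}) * (eps v (A - {w}) * f (insert v (A - {w}))) =
        - (eps v A * (eps w (insert v A - {w}) * f (insert v A - {w})))"
      unfolding B(2) unfolding B_def[symmetric] mult.assoc[symmetric] by simp
  qed
  also have "\<dots> = (\<Sum>v\<in>W1 - A. \<Sum>w\<in>insert v A \<inter> W2.
      - (eps v A * (eps w (insert v A - {w}) * f (insert v A - {w}))))"
    using assms by (subst sum.swap, intro sum.cong) auto
  also have "\<dots> = - del W1 (cod W2 f) A"
    by (simp add: del_def cod_def sum_distrib_left sum_negf)
  finally show ?thesis .
qed

lemma del_del:
  assumes "U \<subseteq> V" "A \<subseteq> V"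
  shows "del U (del U f) A = 0"
proof -
  define T where "T = (\<lambda>v w. eps v A * (eps w (insert v A) * f (insert w (insert v A))))"
  \<comment> \<open>Zeroing the diagonal lets both indices range over \<open>U - A\<close>, where
    the summand is antisymmetric.\<close>
  define g where "g = (\<lambda>v w. if v = w then 0 else T v w)"
  have fin: "finite (U - A)" using assms finite_sub by blast
  have eq: "del U (del U f) A = (\<Sum>v\<in>U - A. \<Sum>w\<in>U - A. g v w)"
    unfolding del_def sum_distrib_left
  proof (rule sum.cong[OF refl])
    fix v assume v: "v \<in> U - A"
    have "(\<Sum>w\<in>U - insert v A. T v w) = (\<Sum>w\<in>U - insert v A. g v w)"
      by (intro sum.cong) (auto simp: g_def)
    also have "\<dots> = (\<Sum>w\<in>U - A. g v w)"
      using fin by (intro sum.mono_neutral_left) (auto simp: g_def)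
    finally show "(\<Sum>n\<in>U - insert v A. eps v A * (eps n (insert v A) * f (insert n (insert v A))))
      = (\<Sum>w\<in>U - A. g v w)" unfolding T_def .
  qed
  have "g v w = - g w v" if "v \<in> U - A" "w \<in> U - A" for v w
  proof (cases "v = w")
    case False
    then have "eps v (insert w A) * eps w A = - (eps w (insert v A) * eps v A)"
      using that assms by (intro eps_swap) auto
    then have "eps w (insert v A) * eps v A * f (insert w (insert v A))
       = - (eps v (insert w A) * eps w A) * f (insert v (insert w A))"
      by (simp add: insert_commute)
    then show ?thesis using False by (simp add: g_def T_def algebra_simps)
  qed (simp add: g_def)
  then have "(\<Sum>v\<in>U - A. \<Sum>w\<in>U - A. g v w) = (\<Sum>v\<in>U - A. \<Sum>w\<in>U - A. - g w v)"
    by (intro sum.cong refl) blast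
  also have "\<dots> = - (\<Sum>v\<in>U - A. \<Sum>w\<in>U - A. g v w)"
    by (subst sum.swap) (simp add: sum_negf)
  finally show ?thesis unfolding eq by simp
qed

text \<open>Coning with apex \<open>u\<close> is a contracting homotopy, so the full simplex on
  \<open>U\<close> is acyclic. Insertions of vertices other than \<open>u\<close> cancel by
  anticommutation; of the two terms left, one is zero and the other carries a squared sign.\<close>

lemma del_contraction:
  assumes "U \<subseteq> V" "u \<in> U" "A \<subseteq> U"
  shows "del U (cod {u} f) A + cod {u} (del U f) A = f A"
proof -
  define W where "W = U - {u}"
  have U: "U = W \<union> {u}" "W \<inter> {u} = {}" "W \<subseteq> V" "{u} \<subseteq> V" using assms by (auto simp: W_def)
  have dU: "del U g B = del W g B + del {u} g B" for g B
    using U del_Un by metis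
  have "cod {u} (del U f) A = cod {u} (del W f) A + cod {u} (del {u} f) A"
    unfolding dU[abs_def] by (simp add: cod_def sum.distrib algebra_simps)
  moreover have "cod {u} (del W f) A = - del W (cod {u} f) A"
    using assms U by (intro cod_del_anticommute) auto
  moreover have "del {u} (cod {u} f) A + cod {u} (del {u} f) A = f A"
  proof (cases "u \<in> A")
    case True
    have "del {u} (cod {u} f) A = 0"
      using True by (simp add: del_def)
    moreover have "cod {u} (del {u} f) A = eps u (A - {u}) * del {u} f (A - {u})"
      using True by (simp add: cod_def)
    moreover have "{u} - (A - {u}) = {u}" "insert u (A - {u}) = A"
      using True by blast+
    then have "del {u} f (A - {u}) = eps u (A - {u}) * f A"
      unfolding del_def by simp
    ultimately show ?thesis by (simp add: eps_sq_left)
  next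
    case False
    have "cod {u} (del {u} f) A = 0"
      using False by (simp add: cod_def)
    moreover have "{u} - A = {u}" "insert u A \<inter> {u} = {u}" "insert u A - {u} = A"
      using False by blast+
    then have "del {u} (cod {u} f) A = eps u A * cod {u} f (insert u A)"
        "cod {u} f (insert u A) = eps u A * f A"
      unfolding del_def cod_def by simp_all
    ultimately show ?thesis by (simp add: eps_sq_left)
  qed
  ultimately show ?thesis unfolding dU by simp
qed

text \<open>Both sides sum over the pairs of subsets of \<open>U\<close> that differ by one vertex
  of \<open>W\<close>, indexed once by the smaller and once by the larger set.\<close>

lemma del_cod_adjoint:
  assumes "W \<subseteq> U" "U \<subseteq> V"
  shows "(\<Sum>A\<in>Pow U. f A * del W g A) = (\<Sum>A\<in>Pow U. cod W f A * g A)"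
proof -
  have fU: "finite U" using assms by auto
  have fin: "finite (W - A)" "finite (A \<inter> W)" for A using fU assms(1) finite_subset by blast+
  have "(\<Sum>A\<in>Pow U. f A * del W g A)
      = (\<Sum>(A,v)\<in>Sigma (Pow U) (\<lambda>A. W - A). eps v A * f A * g (insert v A))"
    unfolding del_def sum_distrib_left using fU fin
    by (subst sum.Sigma) (auto simp: mult_ac intro!: sum.cong)
  also have "\<dots> = (\<Sum>(A,v)\<in>Sigma (Pow U) (\<lambda>A. A \<inter> W). eps v (A - {v}) * f (A - {v}) * g A)"
  proof (rule sum.reindex_bij_witness[where i = "\<lambda>(A,v). (A - {v}, v)" and j = "\<lambda>(A,v). (insert v A, v)"])
    fix x assume "x \<in> Sigma (Pow U) (\<lambda>A. W - A)"
    then obtain A v where x: "x = (A, v)" "A \<subseteq> U" "v \<in> W" "v \<notin> A" by blast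
    then have A: "insert v A - {v} = A" by blast
    show "(case case x of (A, v) \<Rightarrow> (insert v A, v) of (A, v) \<Rightarrow> (A - {v}, v)) = x"
      "(case case x of (A, v) \<Rightarrow> (insert v A, v) of
         (A, v) \<Rightarrow> eps v (A - {v}) * f (A - {v}) * g A) =
       (case x of (A, v) \<Rightarrow> eps v A * f A * g (insert v A))"
      unfolding x(1) prod.case A by (rule refl)+
    show "(case x of (A, v) \<Rightarrow> (insert v A, v)) \<in> Sigma (Pow U) (\<lambda>A. A \<inter> W)"
      using x assms(1) by auto
  next
    fix y assume "y \<in> Sigma (Pow U) (\<lambda>A. A \<inter> W)"
    then obtain A v where y: "y = (A, v)" "A \<subseteq> U" "v \<in> W" "v \<in> A" by blast
    then have A: "insert v (A - {v}) = A" by blast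
    show "(case case y of (A, v) \<Rightarrow> (A - {v}, v) of (A, v) \<Rightarrow> (insert v A, v)) = y"
      unfolding y(1) prod.case A by (rule refl)
    show "(case y of (A, v) \<Rightarrow> (A - {v}, v)) \<in> Sigma (Pow U) (\<lambda>A. W - A)"
      using y by auto
  qed
  also have "\<dots> = (\<Sum>A\<in>Pow U. cod W f A * g A)"
    unfolding cod_def sum_distrib_right using fU fin
    by (subst sum.Sigma) auto
  finally show ?thesis .
qed

section \<open>Harmonic functions on nonfaces\<close>

text \<open>
  Here \<open>N\<close> is the set of nonfaces. The boundary is only required to vanish on \<open>N\<close>, because relative
  chains are taken modulo functions on faces.
\<close>

definition harmonic :: "'a set \<Rightarrow> 'a set set \<Rightarrow> ('a set \<Rightarrow> real) \<Rightarrow> bool" where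
  "harmonic U N h \<longleftrightarrow>
     (\<forall>A. h A \<noteq> 0 \<longrightarrow> A \<subseteq> U \<and> A \<in> N) \<and>
     (\<forall>A\<in>N. A \<subseteq> U \<longrightarrow> del U h A = 0) \<and>
     (\<forall>A\<subseteq>U. cod U h A = 0)"

text \<open>Ranging over all \<open>U \<subseteq> W\<close> mirrors the induced subcomplexes in
  \<open>Leray\<close>. A size \<open>k > 0\<close> stands for nonzero reduced homology in degree
  \<open>k - 2\<close>.\<close>

definition harmonic_cards :: "'a set \<Rightarrow> 'a set set \<Rightarrow> nat set" where
  "harmonic_cards W N = {card A |A. \<exists>U h. U \<subseteq> W \<and> harmonic U N h \<and> h A \<noteq> 0}"

text \<open>The sign of sorting \<open>A\<close> followed by \<open>B\<close>. It translates between
  the concatenated orientation natural for tensor products and the fixed vertex order.\<close>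

definition shuffle_sign :: "'a set \<Rightarrow> 'a set \<Rightarrow> real" where
  "shuffle_sign A B = (\<Prod>u\<in>A. eps u B)"

lemma shuffle_sign_nonzero: "shuffle_sign A B \<noteq> 0"
  by (cases "finite A") (simp_all add: shuffle_sign_def eps_nonzero)

lemma shuffle_sign_insert_left:
  "finite A \<Longrightarrow> v \<notin> A \<Longrightarrow> shuffle_sign (insert v A) B = eps v B * shuffle_sign A B"
  by (simp add: shuffle_sign_def)

text \<open>Each \<open>u \<in> A\<close> contributes \<open>s v u\<close> where
  \<open>eps v A\<close> has \<open>s u v\<close>. The resulting power of \<open>-1\<close> is the
  Koszul sign of a tensor product of complexes.\<close>

lemma shuffle_sign_insert_right:
  assumes "A \<subseteq> V" "B \<subseteq> V" "v \<in> V" "v \<notin> A" "v \<notin> B"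
  shows "shuffle_sign A (insert v B) = (-1) ^ card A * eps v A * shuffle_sign A B"
proof -
  have "finite B" using assms by simp
  have "shuffle_sign A (insert v B) = (\<Prod>u\<in>A. (-1) * s u v * eps u B)"
    unfolding shuffle_sign_def
  proof (rule prod.cong[OF refl])
    fix u assume "u \<in> A"
    then have "s v u = - s u v" using assms by (intro s_swap) auto
    then show "eps u (insert v B) = (-1) * s u v * eps u B"
      using assms \<open>finite B\<close> by (simp add: eps_insert)
  qed
  also have "\<dots> = (-1) ^ card A * eps v A * shuffle_sign A B"
    by (simp only: prod.distrib eps_def shuffle_sign_def prod_constant)
  finally show ?thesis .
qed

text \<open>
  The squared norms of boundary and coboundary of \<open>h\<close> add up to \<open>0\<close>. The mixed terms in their
  expansion cancel by adjointness and anticommutation, so all four partial operators vanish on \<open>h\<close>.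
\<close>

lemma harmonic_join_split:
  assumes "U1 \<subseteq> V" "U2 \<subseteq> V" "U1 \<inter> U2 = {}"
    and N: "\<And>A. A \<subseteq> U1 \<union> U2 \<Longrightarrow> A \<in> N \<longleftrightarrow> A \<inter> U1 \<in> N1 \<and> A \<inter> U2 \<in> N2"
    and h: "harmonic (U1 \<union> U2) N h"
    and A: "A \<subseteq> U1 \<union> U2"
  shows "A \<in> N \<Longrightarrow> del U1 h A = 0" "cod U1 h A = 0"
proof -
  define U where "U = U1 \<union> U2"
  have U: "U1 \<subseteq> U" "U2 \<subseteq> U" "U \<subseteq> V" "finite U" using assms by (auto simp: U_def)
  define n where "n = (\<lambda>A. if A \<in> N then 1 else 0::real)"
  have supp: "h A \<noteq> 0 \<Longrightarrow> A \<in> N" for A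
    using h unfolding harmonic_def by blast
  have off: "del U1 h B * del U2 h B = 0" if B: "B \<subseteq> U" "B \<notin> N" for B
  proof -
    have "B \<inter> U1 \<notin> N1 \<or> B \<inter> U2 \<notin> N2" using N B U_def by blast
    then show ?thesis
    proof
      assume *: "B \<inter> U1 \<notin> N1"
      have "h (insert v B) = 0" if "v \<in> U2 - B" for v
      proof -
        have "insert v B \<inter> U1 = B \<inter> U1" "insert v B \<subseteq> U1 \<union> U2"
          using that assms(3) B by (auto simp: U_def)
        then show ?thesis using * N supp by metis
      qed
      then show ?thesis unfolding del_def by simp
    next
      assume *: "B \<inter> U2 \<notin> N2"
      have "h (insert v B) = 0" if "v \<in> U1 - B" for v
      proof -
        have "insert v B \<inter> U2 = B \<inter> U2" "insert v B \<subseteq> U1 \<union> U2"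
          using that assms(3) B by (auto simp: U_def)
        then show ?thesis using * N supp by metis
      qed
      then show ?thesis unfolding del_def by simp
    qed
  qed
  have "(\<Sum>B\<in>Pow U. del U1 h B * del U2 h B) = (\<Sum>B\<in>Pow U. cod U2 (del U1 h) B * h B)"
    using U by (intro del_cod_adjoint)
  also have "\<dots> = (\<Sum>B\<in>Pow U. - (h B * del U1 (cod U2 h) B))"
    using assms U by (intro sum.cong) (auto simp: cod_del_anticommute)
  also have "\<dots> = - (\<Sum>B\<in>Pow U. cod U1 h B * cod U2 h B)"
    using U by (simp add: sum_negf del_cod_adjoint)
  finally have cross: "(\<Sum>B\<in>Pow U. n B * (del U1 h B * del U2 h B))
      = - (\<Sum>B\<in>Pow U. cod U1 h B * cod U2 h B)"
    by (subst sum.cong[where h = "\<lambda>B. del U1 h B * del U2 h B"]) (use off in \<open>auto simp: n_def\<close>)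
  have "n B * (del U1 h B + del U2 h B)\<^sup>2 + (cod U1 h B + cod U2 h B)\<^sup>2 = 0"
    if "B \<subseteq> U" for B
  proof -
    have "n B * del U h B = 0" "cod U h B = 0"
      using h that by (auto simp: harmonic_def n_def U_def)
    then show ?thesis
      using del_Un[OF assms(1-3), of h B] cod_Un[OF assms(1-3), of h B] by (auto simp: U_def)
  qed
  then have "0 = (\<Sum>B\<in>Pow U. n B * (del U1 h B + del U2 h B)\<^sup>2 + (cod U1 h B + cod U2 h B)\<^sup>2)"
    by simp
  also have "\<dots> = (\<Sum>B\<in>Pow U. n B * ((del U1 h B)\<^sup>2 + (del U2 h B)\<^sup>2) + ((cod U1 h B)\<^sup>2 + (cod U2 h B)\<^sup>2)
      + 2 * (n B * (del U1 h B * del U2 h B)) + 2 * (cod U1 h B * cod U2 h B))"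
    by (intro sum.cong) (simp_all add: power2_eq_square algebra_simps)
  also have "\<dots> = (\<Sum>B\<in>Pow U. n B * ((del U1 h B)\<^sup>2 + (del U2 h B)\<^sup>2) + ((cod U1 h B)\<^sup>2 + (cod U2 h B)\<^sup>2))"
    by (simp only: sum.distrib cross flip: sum_distrib_left)
  finally have "n A * ((del U1 h A)\<^sup>2 + (del U2 h A)\<^sup>2) + ((cod U1 h A)\<^sup>2 + (cod U2 h A)\<^sup>2) = 0"
    using A \<open>finite U\<close> by (subst (asm) eq_commute, subst (asm) sum_nonneg_eq_0_iff) (auto simp: n_def U_def)
  moreover have "n A * ((del U1 h A)\<^sup>2 + (del U2 h A)\<^sup>2) \<ge> 0" by (simp add: n_def)
  ultimately have *: "n A * ((del U1 h A)\<^sup>2 + (del U2 h A)\<^sup>2) = 0" "(cod U1 h A)\<^sup>2 + (cod U2 h A)\<^sup>2 = 0"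
    by (smt (verit) zero_le_power2)+
  show "cod U1 h A = 0" using *(2) by (simp add: sum_power2_eq_zero_iff)
  show "del U1 h A = 0" if "A \<in> N" using *(1) that by (simp add: n_def sum_power2_eq_zero_iff)
qed

text \<open>The partial operators over \<open>U1\<close> leave the trace \<open>C\<close> alone, and
  the shuffle sign absorbs the factor \<open>eps v C\<close>. As \<open>C\<close> is a nonface,
  \<open>B \<union> C\<close> is a nonface exactly when \<open>B\<close> is.\<close>

lemma harmonic_join_slice:
  assumes "U1 \<subseteq> V" "U2 \<subseteq> V" "U1 \<inter> U2 = {}"
    and N: "\<And>A. A \<subseteq> U1 \<union> U2 \<Longrightarrow> A \<in> N \<longleftrightarrow> A \<inter> U1 \<in> N1 \<and> A \<inter> U2 \<in> N2"
    and h: "harmonic (U1 \<union> U2) N h"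
    and C: "C \<subseteq> U2" "C \<in> N2"
  shows "harmonic U1 N1 (\<lambda>B. if B \<subseteq> U1 then shuffle_sign B C * h (B \<union> C) else 0)"
    (is "harmonic U1 N1 ?k")
proof -
  note split = harmonic_join_split[OF assms(1-3) N h]
  have N1: "B \<union> C \<in> N \<longleftrightarrow> B \<in> N1" if "B \<subseteq> U1" for B
  proof -
    have "(B \<union> C) \<inter> U1 = B" "(B \<union> C) \<inter> U2 = C" "B \<union> C \<subseteq> U1 \<union> U2"
      using that C assms(3) by auto
    then show ?thesis using N[of "B \<union> C"] C by simp
  qed
  have fin: "finite B" "finite C" if "B \<subseteq> U1" for B
    using that C assms(1,2) by (meson finite_sub subset_trans)+
  have delk: "del U1 ?k B = shuffle_sign B C * del U1 h (B \<union> C)" if B: "B \<subseteq> U1" for B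
  proof -
    have "U1 - (B \<union> C) = U1 - B" using C assms(3) by blast
    moreover have "eps v B * ?k (insert v B) = shuffle_sign B C * (eps v (B \<union> C) * h (insert v (B \<union> C)))"
      if "v \<in> U1 - B" for v
    proof -
      have "B \<inter> C = {}" using B C assms(3) by blast
      then show ?thesis
        using that B fin[OF B] by (simp add: shuffle_sign_insert_left eps_Un algebra_simps)
    qed
    ultimately show ?thesis unfolding del_def sum_distrib_left by (metis (no_types, lifting) sum.cong)
  qed
  have codk: "cod U1 ?k B = shuffle_sign B C * cod U1 h (B \<union> C)" if B: "B \<subseteq> U1" for B
  proof -
    have "(B \<union> C) \<inter> U1 = B \<inter> U1" using C assms(3) by blast
    moreover have "eps v (B - {v}) * ?k (B - {v}) = shuffle_sign B C * (eps v (B \<union> C - {v}) * h (B \<union> C - {v}))"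
      if "v \<in> B \<inter> U1" for v
    proof -
      have BC: "(B - {v}) \<inter> C = {}" "B \<union> C - {v} = (B - {v}) \<union> C" "B - {v} \<subseteq> U1"
        using B C assms(3) that by blast+
      have "shuffle_sign B C = eps v C * shuffle_sign (B - {v}) C"
        using that fin[OF B] shuffle_sign_insert_left[of "B - {v}" v C] by (simp add: insert_absorb)
      then show ?thesis
        unfolding BC(2) using BC fin[OF B] by (simp add: eps_Un eps_sq_left algebra_simps)
    qed
    ultimately show ?thesis unfolding cod_def sum_distrib_left by (metis (no_types, lifting) sum.cong)
  qed
  have "B \<in> N1" if "B \<subseteq> U1" "h (B \<union> C) \<noteq> 0" for B
    using that N1 h by (auto simp: harmonic_def)
  moreover have "B \<union> C \<subseteq> U1 \<union> U2" if "B \<subseteq> U1" for B using that C by blast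
  ultimately show ?thesis
    unfolding harmonic_def using split N1 by (auto simp: delk codk split: if_splits)
qed

text \<open>This is the tensor product of \<open>h1\<close> and \<open>h2\<close>: up to a factor,
  each partial operator on \<open>h\<close> is the operator of one factor at the corresponding
  trace, so it vanishes where required.\<close>

lemma harmonic_join:
  assumes "U1 \<subseteq> V" "U2 \<subseteq> V" "U1 \<inter> U2 = {}"
    and N: "\<And>A. A \<subseteq> U1 \<union> U2 \<Longrightarrow> A \<in> N \<longleftrightarrow> A \<inter> U1 \<in> N1 \<and> A \<inter> U2 \<in> N2"
    and h1: "harmonic U1 N1 h1" and h2: "harmonic U2 N2 h2"
  defines "h \<equiv> \<lambda>A. if A \<subseteq> U1 \<union> U2
      then shuffle_sign (A \<inter> U1) (A \<inter> U2) * h1 (A \<inter> U1) * h2 (A \<inter> U2) else 0"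
  shows "harmonic (U1 \<union> U2) N h"
proof -
  have key: "del U1 h A = shuffle_sign (A \<inter> U1) (A \<inter> U2) * h2 (A \<inter> U2) * del U1 h1 (A \<inter> U1)"
    "del U2 h A = (-1) ^ card (A \<inter> U1) * shuffle_sign (A \<inter> U1) (A \<inter> U2) * h1 (A \<inter> U1) * del U2 h2 (A \<inter> U2)"
    "cod U1 h A = shuffle_sign (A \<inter> U1) (A \<inter> U2) * h2 (A \<inter> U2) * cod U1 h1 (A \<inter> U1)"
    "cod U2 h A = (-1) ^ card (A \<inter> U1) * shuffle_sign (A \<inter> U1) (A \<inter> U2) * h1 (A \<inter> U1) * cod U2 h2 (A \<inter> U2)"
    if A: "A \<subseteq> U1 \<union> U2" for A
  proof -
    define A1 A2 where "A1 = A \<inter> U1" and "A2 = A \<inter> U2"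
    have A12: "A = A1 \<union> A2" "A1 \<inter> A2 = {}" "A1 \<subseteq> U1" "A2 \<subseteq> U2"
      using A assms(3) by (auto simp: A1_def A2_def)
    have sub: "A1 \<subseteq> V" "A2 \<subseteq> V" using A12 assms(1,2) by auto
    then have fin: "finite A1" "finite A2" by auto
    have hh: "h (B1 \<union> B2) = shuffle_sign B1 B2 * h1 B1 * h2 B2" if "B1 \<subseteq> U1" "B2 \<subseteq> U2" for B1 B2
    proof -
      have "(B1 \<union> B2) \<inter> U1 = B1" "(B1 \<union> B2) \<inter> U2 = B2" using that assms(3) by auto
      then show ?thesis using that by (auto simp: h_def)
    qed
    have "eps v A * h (insert v A) = shuffle_sign A1 A2 * h2 A2 * (eps v A1 * h1 (insert v A1))"
      if "v \<in> U1 - A1" for v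
    proof -
      have "insert v A = insert v A1 \<union> A2" using A12 by blast
      then have "h (insert v A) = shuffle_sign (insert v A1) A2 * h1 (insert v A1) * h2 A2"
        using hh[of "insert v A1" A2] that A12 by simp
      moreover have "eps v A = eps v A1 * eps v A2" using A12 fin eps_Un by simp
      ultimately show ?thesis
        using that fin by (simp add: shuffle_sign_insert_left eps_sq_left algebra_simps)
    qed
    moreover have "U1 - A = U1 - A1" by (auto simp: A1_def)
    ultimately show "del U1 h A = shuffle_sign (A \<inter> U1) (A \<inter> U2) * h2 (A \<inter> U2) * del U1 h1 (A \<inter> U1)"
      unfolding del_def sum_distrib_left A1_def[symmetric] A2_def[symmetric]
      by (metis (no_types, lifting) sum.cong)
    have "eps v A * h (insert v A) =
        (-1) ^ card A1 * shuffle_sign A1 A2 * h1 A1 * (eps v A2 * h2 (insert v A2))"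
      if "v \<in> U2 - A2" for v
    proof -
      have "insert v A = A1 \<union> insert v A2" using A12 by blast
      then have "h (insert v A) = shuffle_sign A1 (insert v A2) * h1 A1 * h2 (insert v A2)"
        using hh[of A1 "insert v A2"] that A12 by simp
      moreover have "eps v A = eps v A1 * eps v A2" using A12 fin eps_Un by simp
      moreover have "shuffle_sign A1 (insert v A2) = (-1) ^ card A1 * eps v A1 * shuffle_sign A1 A2"
        using that sub A12 assms(2,3) by (intro shuffle_sign_insert_right) auto
      ultimately show ?thesis
        by (simp add: eps_sq_left algebra_simps)
    qed
    moreover have "U2 - A = U2 - A2" by (auto simp: A2_def)
    ultimately show "del U2 h A = (-1) ^ card (A \<inter> U1) * shuffle_sign (A \<inter> U1) (A \<inter> U2) * h1 (A \<inter> U1) * del U2 h2 (A \<inter> U2)"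
      unfolding del_def sum_distrib_left A1_def[symmetric] A2_def[symmetric]
      by (metis (no_types, lifting) sum.cong)
    have "eps v (A - {v}) * h (A - {v}) = shuffle_sign A1 A2 * h2 A2 * (eps v (A1 - {v}) * h1 (A1 - {v}))"
      if "v \<in> A1" for v
    proof -
      have B: "A - {v} = (A1 - {v}) \<union> A2" "(A1 - {v}) \<inter> A2 = {}" "A1 - {v} \<subseteq> U1"
        using A12 that by blast+
      then have "h (A - {v}) = shuffle_sign (A1 - {v}) A2 * h1 (A1 - {v}) * h2 A2"
        using hh[of "A1 - {v}" A2] A12 by simp
      moreover have "eps v (A - {v}) = eps v (A1 - {v}) * eps v A2" using B fin eps_Un by simp
      moreover have "shuffle_sign A1 A2 = eps v A2 * shuffle_sign (A1 - {v}) A2"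
        using that fin shuffle_sign_insert_left[of "A1 - {v}" v A2] by (simp add: insert_absorb)
      ultimately show ?thesis
        by (simp add: algebra_simps)
    qed
    moreover have "A1 \<inter> U1 = A1" using A12 by blast
    ultimately show "cod U1 h A = shuffle_sign (A \<inter> U1) (A \<inter> U2) * h2 (A \<inter> U2) * cod U1 h1 (A \<inter> U1)"
      unfolding cod_def sum_distrib_left A1_def[symmetric] A2_def[symmetric]
      by (metis (no_types, lifting) sum.cong)
    have "eps v (A - {v}) * h (A - {v}) =
        (-1) ^ card A1 * shuffle_sign A1 A2 * h1 A1 * (eps v (A2 - {v}) * h2 (A2 - {v}))"
      if "v \<in> A2" for v
    proof -
      have B: "A - {v} = A1 \<union> (A2 - {v})" "A1 \<inter> (A2 - {v}) = {}" "A2 - {v} \<subseteq> U2" "insert v (A2 - {v}) = A2"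
        using A12 that by blast+
      then have "h (A - {v}) = shuffle_sign A1 (A2 - {v}) * h1 A1 * h2 (A2 - {v})"
        using hh[of A1 "A2 - {v}"] A12 by simp
      moreover have "eps v (A - {v}) = eps v A1 * eps v (A2 - {v})" using B fin eps_Un by simp
      moreover have "shuffle_sign A1 (insert v (A2 - {v})) = (-1) ^ card A1 * eps v A1 * shuffle_sign A1 (A2 - {v})"
        using that sub A12 by (intro shuffle_sign_insert_right) auto
      moreover have "(-1) ^ card A1 * ((-1) ^ card A1 * x) = x" for x :: real
        by (simp flip: mult.assoc power_mult_distrib)
      ultimately show ?thesis
        unfolding B(4) by (simp add: eps_sq_left algebra_simps)
    qed
    moreover have "A2 \<inter> U2 = A2" using A12 by blast
    ultimately show "cod U2 h A = (-1) ^ card (A \<inter> U1) * shuffle_sign (A \<inter> U1) (A \<inter> U2) * h1 (A \<inter> U1) * cod U2 h2 (A \<inter> U2)"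
      unfolding cod_def sum_distrib_left A1_def[symmetric] A2_def[symmetric]
      by (metis (no_types, lifting) sum.cong)
  qed
  show ?thesis
    unfolding harmonic_def del_Un[OF assms(1-3)] cod_Un[OF assms(1-3)]
  proof (intro conjI allI ballI impI)
    fix A assume "h A \<noteq> 0"
    then have A: "A \<subseteq> U1 \<union> U2" "h1 (A \<inter> U1) \<noteq> 0" "h2 (A \<inter> U2) \<noteq> 0"
      by (auto simp: h_def split: if_splits)
    then show "A \<subseteq> U1 \<union> U2" "A \<in> N"
      using N h1 h2 by (auto simp: harmonic_def)
  next
    fix A assume "A \<in> N" "A \<subseteq> U1 \<union> U2"
    then have "del U1 h1 (A \<inter> U1) = 0" "del U2 h2 (A \<inter> U2) = 0"
      using N h1 h2 by (auto simp: harmonic_def)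
    then show "del U1 h A + del U2 h A = 0"
      using key \<open>A \<subseteq> U1 \<union> U2\<close> by simp
  next
    fix A assume "A \<subseteq> U1 \<union> U2"
    moreover have "cod U1 h1 (A \<inter> U1) = 0" "cod U2 h2 (A \<inter> U2) = 0"
      using h1 h2 by (auto simp: harmonic_def)
    ultimately show "cod U1 h A + cod U2 h A = 0"
      using key by simp
  qed
qed

end

text \<open>Least squares: some combination of the columns of \<open>M\<close> leaves a residual of
  \<open>f\<close> orthogonal to every column. The induction is Gram-Schmidt: a new column is
  replaced by its own residual \<open>s\<close>, along which the old residual \<open>r\<close> of
  \<open>f\<close> is then corrected.\<close>

lemma normal_equations_solvable:
  fixes M :: "'i \<Rightarrow> 'j \<Rightarrow> real" and f :: "'i \<Rightarrow> real"
  assumes "finite I" "finite J"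
  shows "\<exists>k. \<forall>j\<in>J. (\<Sum>i\<in>I. M i j * (f i - (\<Sum>j'\<in>J. M i j' * k j'))) = 0"
  using assms(2)
proof (induction J arbitrary: f)
  case (insert j0 J)
  from insert.IH[of f] obtain k where
    k: "\<And>j. j \<in> J \<Longrightarrow> (\<Sum>i\<in>I. M i j * (f i - (\<Sum>j'\<in>J. M i j' * k j'))) = 0" by blast
  from insert.IH[of "\<lambda>i. M i j0"] obtain k0 where
    k0: "\<And>j. j \<in> J \<Longrightarrow> (\<Sum>i\<in>I. M i j * (M i j0 - (\<Sum>j'\<in>J. M i j' * k0 j'))) = 0" by blast
  define r where "r = (\<lambda>i. f i - (\<Sum>j'\<in>J. M i j' * k j'))"
  define s where "s = (\<lambda>i. M i j0 - (\<Sum>j'\<in>J. M i j' * k0 j'))"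
  define a where "a = (\<Sum>i\<in>I. s i * r i) / (\<Sum>i\<in>I. s i * s i)"
  define k' where "k' = (\<lambda>j. if j = j0 then a else k j - a * k0 j)"
  have res: "f i - (\<Sum>j'\<in>insert j0 J. M i j' * k' j') = r i - a * s i" for i
  proof -
    have "(\<Sum>j'\<in>J. M i j' * k' j') = (\<Sum>j'\<in>J. M i j' * k j' - a * (M i j' * k0 j'))"
      using insert.hyps by (intro sum.cong) (auto simp: k'_def algebra_simps)
    then show ?thesis
      using insert.hyps by (simp add: k'_def r_def s_def sum_subtractf sum_distrib_left algebra_simps)
  qed
  have rJ: "(\<Sum>i\<in>I. M i j * (r i - a * s i)) = 0" if "j \<in> J" for j
  proof -
    have "(\<Sum>i\<in>I. M i j * (r i - a * s i)) = (\<Sum>i\<in>I. M i j * r i) - a * (\<Sum>i\<in>I. M i j * s i)"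
      by (simp add: sum_subtractf sum_distrib_left algebra_simps)
    then show ?thesis using k[OF that] k0[OF that] by (simp add: r_def s_def)
  qed
  have "(\<Sum>i\<in>I. s i * (r i - a * s i)) = 0"
  proof (cases "(\<Sum>i\<in>I. s i * s i) = 0")
    case True
    then have "s i = 0" if "i \<in> I" for i
      using that assms(1) by (subst (asm) sum_nonneg_eq_0_iff) auto
    then show ?thesis by simp
  next
    case False
    have "(\<Sum>i\<in>I. s i * (r i - a * s i)) = (\<Sum>i\<in>I. s i * r i) - a * (\<Sum>i\<in>I. s i * s i)"
      by (simp add: sum_subtractf sum_distrib_left algebra_simps)
    then show ?thesis using False by (simp add: a_def)
  qed
  \<comment> \<open>The new column is \<open>s\<close> plus a combination of old columns, and the
    corrected residual is orthogonal to both parts.\<close>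
  moreover have "M i j0 * q = s i * q + (\<Sum>j\<in>J. k0 j * (M i j * q))" for i q
    by (simp add: s_def algebra_simps sum_distrib_left)
  then have "(\<Sum>i\<in>I. M i j0 * (r i - a * s i)) =
      (\<Sum>i\<in>I. s i * (r i - a * s i)) + (\<Sum>i\<in>I. \<Sum>j\<in>J. k0 j * (M i j * (r i - a * s i)))"
    by (simp only: sum.distrib)
  moreover have "(\<Sum>i\<in>I. \<Sum>j\<in>J. k0 j * (M i j * (r i - a * s i))) = 0"
    by (subst sum.swap) (simp add: rJ flip: sum_distrib_left)
  ultimately have "(\<Sum>i\<in>I. M i j0 * (r i - a * s i)) = 0" by simp
  then show ?case
    using rJ res by (intro exI[of _ k']) simp
qed simp

section \<open>Additivity of the sizes occurring in supports of harmonic functions\<close>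

context vertex_signs begin

lemma del_cong: "(\<And>v. v \<in> W - A \<Longrightarrow> f (insert v A) = g (insert v A)) \<Longrightarrow> del W f A = del W g A"
  by (simp add: del_def)

lemma cod_cong: "(\<And>v. v \<in> A \<inter> W \<Longrightarrow> f (A - {v}) = g (A - {v})) \<Longrightarrow> cod W f A = cod W g A"
  by (simp add: cod_def)

lemma cod_zero: "(\<And>v. v \<in> A \<inter> W \<Longrightarrow> f (A - {v}) = 0) \<Longrightarrow> cod W f A = 0"
  by (simp add: cod_def)

lemma del_zero: "(\<And>v. v \<in> W - A \<Longrightarrow> f (insert v A) = 0) \<Longrightarrow> del W f A = 0"
  by (simp add: del_def)

lemma harmonic_cardsI:
  "harmonic U N h \<Longrightarrow> U \<subseteq> W \<Longrightarrow> h A \<noteq> 0 \<Longrightarrow> card A \<in> harmonic_cards W N"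
  by (auto simp: harmonic_cards_def)

lemma finite_harmonic_cards:
  assumes "W \<subseteq> V"
  shows "finite (harmonic_cards W N)"
proof (rule finite_subset)
  show "harmonic_cards W N \<subseteq> {..card V}"
    using assms finite_V by (auto simp: harmonic_cards_def harmonic_def intro!: card_mono)
qed simp

text \<open>Inside \<open>M\<close> there is neither a vertex to insert into \<open>M\<close> nor a
  set containing \<open>M\<close> properly. For the nonfaces of a complex this is the relative class
  of a simplex modulo its boundary sphere.\<close>

lemma harmonic_indicator_minimal:
  assumes "M \<in> N" "\<And>B. B \<in> N \<Longrightarrow> B \<subseteq> M \<Longrightarrow> B = M"
  shows "harmonic M N (\<lambda>A. if A = M then 1 else 0)"
  unfolding harmonic_def
proof (intro conjI allI ballI impI)
  fix A assume "A \<in> N" "A \<subseteq> M"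
  then have "M - A = {}" using assms(2) by blast
  then show "del M (\<lambda>A. if A = M then 1 else 0) A = 0"
    unfolding del_def by (simp only: sum.empty)
next
  fix A show "cod M (\<lambda>A. if A = M then 1 else 0) A = 0" by (rule cod_zero) auto
qed (auto split: if_splits simp: assms(1))

text \<open>Makes \<open>Max\<close> of these sizes meaningful. That the size belongs to a member of
  \<open>N\<close> is needed in \<open>Leray_iff\<close> for \<open>U = {}\<close>.\<close>

lemma harmonic_cards_minimal:
  assumes "W \<subseteq> V" "W \<in> N"
  shows "\<exists>M\<in>N. M \<subseteq> W \<and> card M \<in> harmonic_cards W N"
proof -
  have "finite {A \<in> N. A \<subseteq> W}"
    by (rule finite_subset[of _ "Pow W"]) (use assms(1) finite_sub in auto)
  from finite_has_minimal2[OF this, of W] assms(2) obtain M where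
    M: "M \<in> N" "M \<subseteq> W" and min: "\<forall>B\<in>{A \<in> N. A \<subseteq> W}. B \<subseteq> M \<longrightarrow> M = B"
    by blast
  have "harmonic M N (\<lambda>A. if A = M then 1 else 0)"
  proof (rule harmonic_indicator_minimal)
    show "B = M" if "B \<in> N" "B \<subseteq> M" for B using min M that by blast
  qed (rule M(1))
  then have "card M \<in> harmonic_cards W N"
    by (rule harmonic_cardsI) (use M in simp_all)
  then show ?thesis using M by blast
qed

lemma harmonic_cards_cong:
  assumes "\<And>A. A \<subseteq> W \<Longrightarrow> A \<in> N \<longleftrightarrow> A \<in> N'"
  shows "harmonic_cards W N = harmonic_cards W N'"
proof -
  have "harmonic U N h \<longleftrightarrow> harmonic U N' h" if "U \<subseteq> W" for U h
    using assms that unfolding harmonic_def by (meson subset_trans)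
  then show ?thesis unfolding harmonic_cards_def by blast
qed

text \<open>A nonzero value at \<open>A1 \<union> A2\<close> survives in the slice through
  \<open>A2\<close> and in the slice through \<open>A1\<close>; conversely, the product of two
  harmonic functions is nonzero at the union of two sets where they are nonzero.\<close>

lemma harmonic_cards_join:
  assumes "V1 \<subseteq> V" "V2 \<subseteq> V" "V1 \<inter> V2 = {}"
  shows "harmonic_cards (V1 \<union> V2) {A. A \<inter> V1 \<in> N1 \<and> A \<inter> V2 \<in> N2} =
    {a + b |a b. a \<in> harmonic_cards V1 N1 \<and> b \<in> harmonic_cards V2 N2}"
    (is "harmonic_cards _ ?N = ?R")
proof (intro equalityI subsetI)
  fix c assume "c \<in> harmonic_cards (V1 \<union> V2) ?N"
  then obtain A U h where A: "c = card A" "U \<subseteq> V1 \<union> V2" "harmonic U ?N h" "h A \<noteq> 0"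
    by (auto simp: harmonic_cards_def)
  define U1 U2 where "U1 = U \<inter> V1" and "U2 = U \<inter> V2"
  define A1 A2 where "A1 = A \<inter> U1" and "A2 = A \<inter> U2"
  have U: "U = U1 \<union> U2" "U1 \<subseteq> V" "U2 \<subseteq> V" "U1 \<inter> U2 = {}" "U1 \<subseteq> V1" "U2 \<subseteq> V2"
    using A assms by (auto simp: U1_def U2_def)
  have mem: "B \<in> ?N \<longleftrightarrow> B \<inter> U1 \<in> N1 \<and> B \<inter> U2 \<in> N2" if "B \<subseteq> U1 \<union> U2" for B
  proof -
    have "B \<inter> U1 = B \<inter> V1" "B \<inter> U2 = B \<inter> V2" using that by (auto simp: U1_def U2_def)
    then show ?thesis by simp
  qed
  have mem': "B \<in> ?N \<longleftrightarrow> B \<inter> U2 \<in> N2 \<and> B \<inter> U1 \<in> N1" if "B \<subseteq> U2 \<union> U1" for B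
    using mem[of B] that by (simp add: Un_commute conj_commute)
  have AU: "A \<subseteq> U1 \<union> U2" "A \<in> ?N" using A U(1) by (auto simp: harmonic_def)
  then have A12: "A1 \<in> N1" "A2 \<in> N2" "A1 \<subseteq> U1" "A2 \<subseteq> U2" "A1 \<union> A2 = A" "A2 \<union> A1 = A" "A1 \<inter> A2 = {}"
    using mem U by (auto simp: A1_def A2_def)
  have "harmonic U1 N1 (\<lambda>B. if B \<subseteq> U1 then shuffle_sign B A2 * h (B \<union> A2) else 0)"
    using A(3) U A12 mem by (intro harmonic_join_slice[where ?U2.0 = U2 and ?N2.0 = N2 and N = ?N]) auto
  then have "card A1 \<in> harmonic_cards V1 N1"
    by (rule harmonic_cardsI) (use U A12 A(4) shuffle_sign_nonzero in simp_all)
  moreover have "harmonic U2 N2 (\<lambda>B. if B \<subseteq> U2 then shuffle_sign B A1 * h (B \<union> A1) else 0)"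
    using A(3) U A12 mem' by (intro harmonic_join_slice[where ?U2.0 = U1 and ?N2.0 = N1 and N = ?N]) (auto simp: Un_commute)
  then have "card A2 \<in> harmonic_cards V2 N2"
    by (rule harmonic_cardsI) (use U A12 A(4) shuffle_sign_nonzero in simp_all)
  moreover have "c = card A1 + card A2"
    unfolding A(1) A12(5)[symmetric]
    using A12 U finite_sub by (intro card_Un_disjoint) (meson subset_trans)+
  ultimately show "c \<in> ?R" by blast
next
  fix c assume "c \<in> ?R"
  then obtain A1 U1 h1 A2 U2 h2 where c: "c = card A1 + card A2"
    and U: "U1 \<subseteq> V1" "U2 \<subseteq> V2" and h: "harmonic U1 N1 h1" "harmonic U2 N2 h2" "h1 A1 \<noteq> 0" "h2 A2 \<noteq> 0"
    by (auto simp: harmonic_cards_def)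
  define h where "h = (\<lambda>A. if A \<subseteq> U1 \<union> U2
      then shuffle_sign (A \<inter> U1) (A \<inter> U2) * h1 (A \<inter> U1) * h2 (A \<inter> U2) else 0)"
  have "harmonic (U1 \<union> U2) ?N h" unfolding h_def
  proof (rule harmonic_join[OF _ _ _ _ h(1,2)])
    fix B assume "B \<subseteq> U1 \<union> U2"
    then have "B \<inter> U1 = B \<inter> V1" "B \<inter> U2 = B \<inter> V2" using U assms(3) by auto
    then show "B \<in> ?N \<longleftrightarrow> B \<inter> U1 \<in> N1 \<and> B \<inter> U2 \<in> N2" by simp
  qed (use U assms in auto)
  moreover have AU: "A1 \<subseteq> U1" "A2 \<subseteq> U2" using h by (auto simp: harmonic_def)
  then have "(A1 \<union> A2) \<inter> U1 = A1" "(A1 \<union> A2) \<inter> U2 = A2" "A1 \<inter> A2 = {}" "A1 \<union> A2 \<subseteq> U1 \<union> U2"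
    using U assms(3) by blast+
  then have "h (A1 \<union> A2) \<noteq> 0" using h(3,4) by (simp add: h_def shuffle_sign_nonzero)
  ultimately have "card (A1 \<union> A2) \<in> harmonic_cards (V1 \<union> V2) ?N"
    using U by (intro harmonic_cardsI) auto
  moreover have "card (A1 \<union> A2) = c"
    unfolding c using \<open>A1 \<inter> A2 = {}\<close> AU U assms(1,2) finite_sub by (intro card_Un_disjoint) (meson subset_trans)+
  ultimately show "c \<in> harmonic_cards (V1 \<union> V2) ?N" by simp
qed

lemma Max_harmonic_cards_join:
  assumes "V1 \<subseteq> V" "V2 \<subseteq> V" "V1 \<inter> V2 = {}" "V1 \<in> N1" "V2 \<in> N2"
  shows "Max (harmonic_cards (V1 \<union> V2) {A. A \<inter> V1 \<in> N1 \<and> A \<inter> V2 \<in> N2}) =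
    Max (harmonic_cards V1 N1) + Max (harmonic_cards V2 N2)"
proof -
  have f: "finite (harmonic_cards V1 N1)" "finite (harmonic_cards V2 N2)"
    using assms finite_harmonic_cards by auto
  have n: "harmonic_cards V1 N1 \<noteq> {}" "harmonic_cards V2 N2 \<noteq> {}"
    using harmonic_cards_minimal[OF assms(1,4)] harmonic_cards_minimal[OF assms(2,5)] by auto
  let ?S = "{a + b |a b. a \<in> harmonic_cards V1 N1 \<and> b \<in> harmonic_cards V2 N2}"
  have "?S = (\<lambda>(a,b). a + b) ` (harmonic_cards V1 N1 \<times> harmonic_cards V2 N2)" by auto
  then have "finite ?S" using f by simp
  then have "Max ?S = Max (harmonic_cards V1 N1) + Max (harmonic_cards V2 N2)"
  proof (rule Max_eqI)
    show "Max (harmonic_cards V1 N1) + Max (harmonic_cards V2 N2) \<in> ?S"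
      using Max_in[OF f(1) n(1)] Max_in[OF f(2) n(2)] by blast
  next
    fix c assume "c \<in> ?S"
    then obtain a b where "c = a + b" "a \<in> harmonic_cards V1 N1" "b \<in> harmonic_cards V2 N2" by blast
    then show "c \<le> Max (harmonic_cards V1 N1) + Max (harmonic_cards V2 N2)"
      using f by (simp add: add_mono)
  qed
  then show ?thesis by (simp only: harmonic_cards_join[OF assms(1-3)])
qed

lemma Max_harmonic_cards_Union:
  assumes "finite I" "disjoint_family_on W I" "\<And>i. i \<in> I \<Longrightarrow> W i \<subseteq> V" "\<And>i. i \<in> I \<Longrightarrow> W i \<in> N i"
  shows "Max (harmonic_cards (\<Union>i\<in>I. W i) {A. \<forall>i\<in>I. A \<inter> W i \<in> N i}) =
    (\<Sum>i\<in>I. Max (harmonic_cards (W i) (N i)))"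
  using assms
proof (induction I rule: finite_induct)
  \<comment> \<open>With no factors every set counts as a nonface, and the only size is
    \<open>0\<close>, matching the empty sum.\<close>
  case empty
  have "harmonic {} UNIV (\<lambda>A. if A = {} then 1 else 0)"
    by (rule harmonic_indicator_minimal) auto
  then have "card ({} :: 'a set) \<in> harmonic_cards {} UNIV"
    by (rule harmonic_cardsI) simp_all
  moreover have "harmonic_cards {} UNIV \<subseteq> {0}"
    by (auto simp: harmonic_cards_def harmonic_def)
  ultimately have "harmonic_cards {} UNIV = {0}" by auto
  then show ?case by simp
next
  case (insert i I)
  let ?W = "\<Union>j\<in>I. W j" and ?N = "{A. \<forall>j\<in>I. A \<inter> W j \<in> N j}"
  have dis: "W i \<inter> ?W = {}"
    using insert.prems(1) insert.hyps(2) by (auto simp: disjoint_family_on_def)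
  have "A \<inter> ?W \<inter> W j = A \<inter> W j" if "j \<in> I" for A j using that by blast
  then have "{A. \<forall>j\<in>insert i I. A \<inter> W j \<in> N j} = {A. A \<inter> W i \<in> N i \<and> A \<inter> ?W \<in> ?N}"
    by simp
  moreover have "?W \<inter> W j = W j" if "j \<in> I" for j using that by blast
  then have "?W \<in> ?N" using insert.prems(3) by simp
  moreover have "Max (harmonic_cards ?W ?N) = (\<Sum>j\<in>I. Max (harmonic_cards (W j) (N j)))"
    using insert.prems by (intro insert.IH) (auto simp: disjoint_family_on_def)
  moreover have "?W \<subseteq> V" using insert.prems(2) by auto
  ultimately show ?case
    using insert.hyps insert.prems(2,3) dis
    by (simp add: Max_harmonic_cards_join[of "W i" ?W "N i" ?N, simplified])
qed

section \<open>Homology and harmonic functions\<close>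

text \<open>Faces are graded by their number \<open>p\<close> of vertices, so this is the reduced homology in degree \<open>p - 1\<close>.\<close>

definition homology_vanishes :: "'a set \<Rightarrow> 'a set set \<Rightarrow> nat \<Rightarrow> bool" where
  "homology_vanishes U X p \<longleftrightarrow>
     (\<forall>z. (\<forall>A. z A \<noteq> 0 \<longrightarrow> A \<subseteq> U \<and> A \<in> X \<and> card A = p) \<longrightarrow> (\<forall>A\<subseteq>U. del U z A = 0) \<longrightarrow>
       (\<exists>g. (\<forall>A. g A \<noteq> 0 \<longrightarrow> A \<subseteq> U \<and> A \<in> X \<and> card A = Suc p) \<and> (\<forall>A\<subseteq>U. del U g A = z A)))"

lemma del_nonzeroE:
  assumes "del W f A \<noteq> 0"
  obtains v where "v \<in> W - A" "f (insert v A) \<noteq> 0"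
proof -
  have "\<exists>v\<in>W - A. f (insert v A) \<noteq> 0"
    using assms by (rule contrapos_np) (rule del_zero, blast)
  then show thesis using that by blast
qed

lemma cod_nonzeroE:
  assumes "cod W f A \<noteq> 0"
  obtains v where "v \<in> A \<inter> W" "f (A - {v}) \<noteq> 0"
proof -
  have "\<exists>v\<in>A \<inter> W. f (A - {v}) \<noteq> 0"
    using assms by (rule contrapos_np) (rule cod_zero, blast)
  then show thesis using that by blast
qed

text \<open>The boundary and its adjoint each change the number of vertices by exactly one, so the
  parts of \<open>h\<close> of different sizes cannot cancel each other.\<close>

lemma harmonic_grade:
  assumes "U \<subseteq> V" "harmonic U N h"
  shows "harmonic U N (\<lambda>A. if card A = q then h A else 0)" (is "harmonic U N ?h")
  unfolding harmonic_def
proof (intro conjI allI ballI impI)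
  fix A assume "?h A \<noteq> 0"
  then show "A \<subseteq> U" "A \<in> N" using assms(2) by (auto simp: harmonic_def split: if_splits)
next
  fix A assume A: "A \<in> N" "A \<subseteq> U"
  then have "finite A" using assms(1) finite_sub by blast
  show "del U ?h A = 0"
  proof (cases "Suc (card A) = q")
    case True
    have "del U ?h A = del U h A"
      using True \<open>finite A\<close> by (intro del_cong) auto
    then show ?thesis using assms(2) A by (simp add: harmonic_def)
  next
    case False
    then show ?thesis using \<open>finite A\<close> by (intro del_zero) auto
  qed
next
  fix A assume A: "A \<subseteq> U"
  then have "finite A" using assms(1) finite_sub by blast
  show "cod U ?h A = 0"
  proof (cases "card A - 1 = q")
    case True
    have "cod U ?h A = cod U h A"
      using True \<open>finite A\<close> by (intro cod_cong) auto
    then show ?thesis using assms(2) A by (simp add: harmonic_def)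
  next
    case False
    then show ?thesis using \<open>finite A\<close> by (intro cod_zero) auto
  qed
qed

text \<open>
  The connecting homomorphism sends \<open>h\<close> to its boundary. If that bounds in the subcomplex, then \<open>h\<close>
  is a relative boundary, and being a cocycle it is orthogonal to itself.
\<close>

lemma harmonic_imp_not_homology_vanishes:
  assumes U: "U \<subseteq> V" "u \<in> U"
    and h: "harmonic U (- X) h" "h A0 \<noteq> 0" "card A0 = Suc p"
  shows "\<not> homology_vanishes U X p"
proof
  assume van: "homology_vanishes U X p"
  have fin: "finite A" if "A \<subseteq> U" for A using that U(1) finite_sub by blast
  define h' where "h' = (\<lambda>A. if card A = Suc p then h A else 0)"
  have h': "harmonic U (- X) h'" unfolding h'_def using U h harmonic_grade by blast
  have h'_supp: "A \<subseteq> U" "A \<notin> X" "card A = Suc p" if "h' A \<noteq> 0" for A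
    using that h' by (auto simp: harmonic_def h'_def split: if_splits)
  define z where "z = (\<lambda>A. if A \<subseteq> U then del U h' A else 0)"
  have "A \<subseteq> U \<and> A \<in> X \<and> card A = p" if "z A \<noteq> 0" for A
  proof -
    have A: "A \<subseteq> U" "del U h' A \<noteq> 0" using that by (auto simp: z_def split: if_splits)
    from this(2) obtain v where "v \<in> U - A" "h' (insert v A) \<noteq> 0" by (rule del_nonzeroE)
    then have "card A = p" using h'_supp(3)[of "insert v A"] fin[OF A(1)] by simp
    then show ?thesis using A h' by (auto simp: harmonic_def)
  qed
  moreover have "del U z A = 0" if "A \<subseteq> U" for A
  proof -
    have "del U z A = del U (del U h') A" using that by (intro del_cong) (simp add: z_def)
    then show ?thesis using del_del that U(1) by simp
  qed
  ultimately obtain g where g: "\<And>A. g A \<noteq> 0 \<Longrightarrow> A \<in> X" "\<And>A. A \<subseteq> U \<Longrightarrow> del U g A = z A"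
    using van[unfolded homology_vanishes_def, rule_format, of z] by auto
  \<comment> \<open>As \<open>g\<close> lives on faces, \<open>w\<close> agrees with
    \<open>h'\<close> on nonfaces. Unlike \<open>h'\<close> it is a cycle of the full simplex, hence
    the boundary of its cone with apex \<open>u\<close>.\<close>
  define w where "w = (\<lambda>A. h' A - g A)"
  have dw: "del U w A = 0" if "A \<subseteq> U" for A
    using that g(2) by (simp add: w_def del_diff z_def)
  have w: "del U (cod {u} w) A = w A" if "A \<subseteq> U" for A
  proof -
    have "cod {u} (del U w) A = 0"
    proof (rule cod_zero)
      show "del U w (A - {v}) = 0" for v by (rule dw) (use that in blast)
    qed
    then show ?thesis using del_contraction[OF U that, of w] by simp
  qed
  have "(\<Sum>A\<in>Pow U. h' A * h' A) = (\<Sum>A\<in>Pow U. h' A * del U (cod {u} w) A)"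
  proof (rule sum.cong[OF refl])
    fix A assume A: "A \<in> Pow U"
    show "h' A * h' A = h' A * del U (cod {u} w) A"
    proof (cases "h' A = 0")
      case False
      then have "w A = h' A" using g(1)[of A] h'_supp(2)[of A] by (auto simp: w_def)
      then show ?thesis using w[of A] A by simp
    qed simp
  qed
  also have "\<dots> = (\<Sum>A\<in>Pow U. cod U h' A * cod {u} w A)"
    using U(1) by (intro del_cod_adjoint) auto
  also have "\<dots> = 0"
    using h' by (intro sum.neutral) (auto simp: harmonic_def)
  finally have "h' A * h' A = 0" if "A \<subseteq> U" for A
    using that fin[of U] by (subst (asm) sum_nonneg_eq_0_iff) auto
  then have "h' A0 = 0" using h(1,2) by (auto simp: harmonic_def)
  then show False using h by (simp add: h'_def)
qed

text \<open>
  A cycle \<open>z\<close> bounds some \<open>w0\<close> in the full simplex. The harmonic function is the component of \<open>w0\<close>,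
  restricted to nonfaces, orthogonal to the relative boundaries.
\<close>

lemma not_homology_vanishes_imp_harmonic:
  assumes U: "U \<subseteq> V" "u \<in> U"
    and X: "\<And>A B. A \<in> X \<Longrightarrow> B \<subseteq> A \<Longrightarrow> B \<in> X"
    and van: "\<not> homology_vanishes U X p"
  shows "\<exists>h A. harmonic U (- X) h \<and> h A \<noteq> 0 \<and> card A = Suc p"
proof -
  have fin: "finite A" if "A \<subseteq> U" for A using that U(1) finite_sub by blast
  from van[unfolded homology_vanishes_def not_all not_imp] obtain z where
    z': "\<forall>A. z A \<noteq> 0 \<longrightarrow> A \<subseteq> U \<and> A \<in> X \<and> card A = p" and
    dz': "\<forall>A\<subseteq>U. del U z A = 0" and
    nz: "\<not> (\<exists>g. (\<forall>A. g A \<noteq> 0 \<longrightarrow> A \<subseteq> U \<and> A \<in> X \<and> card A = Suc p) \<and> (\<forall>A\<subseteq>U. del U g A = z A))"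
    by (elim exE conjE)
  note z = z'[rule_format] and dz = dz'[rule_format]
  \<comment> \<open>The cone over \<open>z\<close> with apex \<open>u\<close>.\<close>
  define w0 where "w0 = cod {u} z"
  have dw0: "del U w0 A = z A" if "A \<subseteq> U" for A
  proof -
    have "cod {u} (del U z) A = 0"
    proof (rule cod_zero)
      show "del U z (A - {v}) = 0" for v by (rule dz) (use that in blast)
    qed
    then show ?thesis using del_contraction[OF U that, of z] by (simp add: w0_def)
  qed
  have w0_card: "card A = Suc p" if A: "A \<subseteq> U" "w0 A \<noteq> 0" for A
  proof -
    obtain v where "v \<in> A \<inter> {u}" "z (A - {v}) \<noteq> 0"
      using A(2) unfolding w0_def by (rule cod_nonzeroE)
    then have "v \<in> A" "z (A - {v}) \<noteq> 0" by blast+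
    then show ?thesis using z[of "A - {v}"] fin[OF A(1)] by (metis card_Suc_Diff1)
  qed
  \<comment> \<open>The set \<open>I\<close> carries the relative chains of the size of
    \<open>w0\<close>; the boundaries of the point masses \<open>\<delta> B\<close> with
    \<open>B \<in> J\<close>, read on \<open>I\<close>, span the relative boundaries among
    them.\<close>
  define I where "I = {A. A \<subseteq> U \<and> A \<notin> X \<and> card A = Suc p}"
  define J where "J = {A. A \<subseteq> U \<and> A \<notin> X \<and> card A = Suc (Suc p)}"
  define \<delta> where "\<delta> = (\<lambda>(B :: 'a set) A. if A = B then 1 else 0 :: real)"
  have finIJ: "finite I" "finite J"
    using fin[of U] by (auto simp: I_def J_def intro: finite_subset[of _ "Pow U"])
  obtain k where k: "\<And>B. B \<in> J \<Longrightarrow>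
      (\<Sum>A\<in>I. del U (\<delta> B) A * (w0 A - (\<Sum>B'\<in>J. del U (\<delta> B') A * k B'))) = 0"
    using normal_equations_solvable[OF finIJ, of "\<lambda>A B. del U (\<delta> B) A" w0] by blast
  define K where "K = (\<lambda>B. if B \<in> J then k B else 0)"
  have dK: "del U K A = (\<Sum>B\<in>J. del U (\<delta> B) A * k B)" for A
  proof -
    have "K B = (\<Sum>B'\<in>J. \<delta> B' B * k B')" for B
    proof -
      have "(\<Sum>B'\<in>J. \<delta> B' B * k B') = (\<Sum>B'\<in>J. if B' = B then k B' else 0)"
        by (intro sum.cong) (auto simp: \<delta>_def)
      then show ?thesis using finIJ by (simp add: K_def sum.delta)
    qed
    then have "del U K A = (\<Sum>v\<in>U - A. \<Sum>B\<in>J. eps v A * \<delta> B (insert v A) * k B)"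
      by (simp add: del_def sum_distrib_left mult.assoc)
    also have "\<dots> = (\<Sum>B\<in>J. del U (\<delta> B) A * k B)"
      by (subst sum.swap) (simp add: del_def sum_distrib_right)
    finally show ?thesis .
  qed
  define w where "w = (\<lambda>A. if A \<subseteq> U then w0 A - del U K A else 0)"
  have w_card: "card A = Suc p" if "w A \<noteq> 0" for A
  proof -
    have A: "A \<subseteq> U" "w0 A \<noteq> 0 \<or> del U K A \<noteq> 0" using that by (auto simp: w_def split: if_splits)
    show ?thesis
    proof (cases "w0 A = 0")
      case True
      then have "del U K A \<noteq> 0" using A by simp
      then obtain v where "v \<in> U - A" "K (insert v A) \<noteq> 0" by (rule del_nonzeroE)
      then show ?thesis using fin[OF A(1)] by (auto simp: K_def J_def split: if_splits)
    qed (use A w0_card in blast)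
  qed
  have dw: "del U w A = z A" if "A \<subseteq> U" for A
  proof -
    have "del U w A = del U (\<lambda>A. w0 A - del U K A) A"
      using that by (intro del_cong) (simp add: w_def)
    then show ?thesis using that dw0 U(1) by (simp add: del_diff del_del)
  qed
  define h where "h = (\<lambda>A. if A \<in> I then w A else 0)"
  have h_w: "h A = w A" if "A \<notin> X" for A
  proof (cases "w A = 0")
    case False
    then have "A \<subseteq> U" by (simp add: w_def split: if_splits)
    then show ?thesis using w_card[OF False] that by (simp add: h_def I_def)
  qed (simp add: h_def)
  have "harmonic U (- X) h" unfolding harmonic_def
  proof (intro conjI allI ballI impI)
    fix A assume "h A \<noteq> 0"
    then show "A \<subseteq> U" "A \<in> - X" by (auto simp: h_def I_def split: if_splits)
  next
    fix A assume A: "A \<in> - X" "A \<subseteq> U"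
    \<comment> \<open>Sets containing a nonface are nonfaces, so discarding the values of
      \<open>w\<close> on faces is not seen by the boundary at \<open>A\<close>.\<close>
    have "del U h A = del U w A"
    proof (intro del_cong h_w)
      show "insert v A \<notin> X" for v using X[of "insert v A" A] A by blast
    qed
    then show "del U h A = 0" using dw[OF A(2)] A(1) z[of A] by auto
  next
    fix B assume B: "B \<subseteq> U"
    show "cod U h B = 0"
    proof (cases "B \<in> J")
      case True
      \<comment> \<open>The value at \<open>B\<close> is the inner product of \<open>h\<close> with
        the boundary of the point mass at \<open>B\<close>, which is zero by the choice of
        \<open>k\<close>.\<close>
      have "cod U h B = (\<Sum>A\<in>Pow U. if A = B then cod U h A else 0)"
        using B fin[of U] by (simp add: sum.delta)
      also have "\<dots> = (\<Sum>A\<in>Pow U. cod U h A * \<delta> B A)"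
        by (intro sum.cong) (auto simp: \<delta>_def)
      also have "\<dots> = (\<Sum>A\<in>Pow U. h A * del U (\<delta> B) A)"
        using U(1) by (intro del_cod_adjoint[symmetric]) auto
      also have "\<dots> = (\<Sum>A\<in>I. h A * del U (\<delta> B) A)"
        using fin[of U] by (intro sum.mono_neutral_right) (auto simp: h_def I_def)
      also have "\<dots> = (\<Sum>A\<in>I. del U (\<delta> B) A * (w0 A - (\<Sum>B'\<in>J. del U (\<delta> B') A * k B')))"
        by (intro sum.cong) (auto simp: h_def w_def dK I_def)
      also have "\<dots> = 0" using k True by blast
      finally show ?thesis .
    next
      case False
      show ?thesis
      proof (rule cod_zero)
        fix v assume v: "v \<in> B \<inter> U"
        have "B - {v} \<notin> I"
        proof
          assume "B - {v} \<in> I"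
          then have "B - {v} \<notin> X" "card (B - {v}) = Suc p" by (auto simp: I_def)
          moreover have "B \<notin> X" using X[of B "B - {v}"] calculation by blast
          moreover have "card B = Suc (card (B - {v}))"
            using card_Suc_Diff1[OF fin[OF B], of v] v by auto
          ultimately show False using False B by (simp add: J_def)
        qed
        then show "h (B - {v}) = 0" by (simp add: h_def)
      qed
    qed
  qed
  moreover have "\<exists>A. h A \<noteq> 0"
  proof (rule ccontr)
    assume "\<not> (\<exists>A. h A \<noteq> 0)"
    \<comment> \<open>Otherwise \<open>w\<close> would live on faces and bound \<open>z\<close>
      inside the subcomplex.\<close>
    then have h0: "h A = 0" for A by simp
    have "A \<subseteq> U \<and> A \<in> X \<and> card A = Suc p" if "w A \<noteq> 0" for A
    proof -
      have "A \<subseteq> U" using that by (simp add: w_def split: if_splits)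
      then show ?thesis using h_w[of A] w_card[of A] that h0 by auto
    qed
    then have "\<exists>g. (\<forall>A. g A \<noteq> 0 \<longrightarrow> A \<subseteq> U \<and> A \<in> X \<and> card A = Suc p) \<and> (\<forall>A\<subseteq>U. del U g A = z A)"
      using dw by (intro exI[of _ w]) simp
    then show False using nz by contradiction
  qed
  then obtain A where "h A \<noteq> 0" by blast
  moreover have "card A = Suc p" using calculation by (auto simp: h_def I_def split: if_splits)
  ultimately show ?thesis by blast
qed

end

section \<open>Chains as functions of vertex sets\<close>

definition alternating :: "('a list \<Rightarrow> real) \<Rightarrow> bool" where
  "alternating c \<longleftrightarrow> (\<forall>xs p. p permutes {..<length xs} \<longrightarrow>
     c (permute_list p xs) = real_of_int (sign p) * c xs)"

lemma alternatingD:
  "alternating c \<Longrightarrow> p permutes {..<length xs} \<Longrightarrow> c (permute_list p xs) = real_of_int (sign p) * c xs"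
  by (simp add: alternating_def)

lemma alternating_swap:
  assumes "alternating c"
  shows "c (ys @ a # b # zs) = - c (ys @ b # a # zs)"
proof -
  let ?n = "length ys" and ?xs = "ys @ b # a # zs"
  let ?p = "Transposition.transpose ?n (Suc ?n)"
  have p: "?p permutes {..<length ?xs}"
    by (rule permutes_swap_id) auto
  have "permute_list ?p ?xs = ys @ a # b # zs"
  proof (rule nth_equalityI)
    fix i assume "i < length (permute_list ?p ?xs)"
    then have i: "i < length ?xs" by simp
    consider "i < ?n" | "i = ?n" | "i = Suc ?n" | "i > Suc ?n" by linarith
    then have "?xs ! ?p i = (ys @ a # b # zs) ! i"
    proof cases
      case 4
      then obtain k where "i = Suc (Suc (?n + k))" using less_iff_Suc_add by auto
      then show ?thesis by (simp add: transpose_def nth_append)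
    qed (simp_all add: transpose_def nth_append)
    then show "permute_list ?p ?xs ! i = (ys @ a # b # zs) ! i"
      by (simp only: permute_list_nth[OF p i])
  qed simp
  then show ?thesis
    using alternatingD[OF assms p] by (simp add: sign_swap_id)
qed

lemma alternating_move:
  assumes "alternating c"
  shows "c (v # ys @ zs) = (-1) ^ length ys * c (ys @ v # zs)"
proof (induction ys arbitrary: zs rule: rev_induct)
  case (snoc y ys)
  have "c (v # (ys @ [y]) @ zs) = (-1) ^ length ys * c (ys @ v # y # zs)"
    using snoc.IH[of "y # zs"] by simp
  also have "c (ys @ v # y # zs) = - c (ys @ y # v # zs)"
    by (rule alternating_swap[OF assms])
  finally show ?case by simp
qed simp

text \<open>\<open>boundary\<close> prepends a vertex, so a permutation of a list has to be extended
  by a fixed first position for the boundary of an alternating function to be alternating.\<close>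

lemma permute_list_Cons:
  assumes p: "p permutes {..<length xs}"
  obtains q where "q permutes {..<length (v # xs)}" "sign q = sign p"
    "permute_list q (v # xs) = v # permute_list p xs"
proof -
  define q where "q = map_permutation {..<length xs} Suc p"
  have "q permutes Suc ` {..<length xs}" unfolding q_def
    using p by (intro map_permutation_permutes) (auto simp: bij_betw_def)
  then have q: "q permutes {..<length (v # xs)}" by (rule permutes_subset) auto
  moreover have "sign q = sign p"
    unfolding q_def using p by (intro sign_map_permutation) auto
  moreover have "permute_list q (v # xs) = v # permute_list p xs"
  proof (rule nth_equalityI)
    fix i assume "i < length (permute_list q (v # xs))"
    then have i: "i < length (v # xs)" by simp
    show "permute_list q (v # xs) ! i = (v # permute_list p xs) ! i"
    proof (cases i)
      case 0
      have "q 0 = 0" unfolding q_def map_permutation_def restrict_id_def by auto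
      then show ?thesis using permute_list_nth[OF q i] 0 by simp
    next
      case (Suc j)
      then have "q (Suc j) = Suc (p j)"
        unfolding q_def using i by (intro map_permutation_apply) auto
      then show ?thesis using permute_list_nth[OF q i] permute_list_nth[OF p, of j] i Suc by simp
    qed
  qed simp
  ultimately show thesis by (rule that)
qed

lemma permute_list_inject:
  assumes "distinct xs" "p permutes {..<length xs}" "q permutes {..<length xs}"
    "permute_list p xs = permute_list q xs"
  shows "p = q"
proof
  fix i show "p i = q i"
  proof (cases "i < length xs")
    case True
    then have "xs ! p i = xs ! q i" using assms permute_list_nth by metis
    moreover have "p i < length xs" "q i < length xs"
      using True permutes_in_image assms(2,3) by (metis lessThan_iff)+
    ultimately show ?thesis using assms(1) nth_eq_iff_index_eq by blast
  next
    case False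
    then show ?thesis using assms(2,3) permutes_not_in by (metis lessThan_iff)
  qed
qed

lemma chainsD:
  assumes "c \<in> chains i X"
  shows "finite {xs. c xs \<noteq> 0}" "alternating c"
    "c xs \<noteq> 0 \<Longrightarrow> distinct xs" "c xs \<noteq> 0 \<Longrightarrow> set xs \<in> X" "c xs \<noteq> 0 \<Longrightarrow> int (length xs) = i + 1"
  using assms by (auto simp: chains_def alternating_def)

lemma chainsI:
  assumes "finite {xs. c xs \<noteq> 0}" "alternating c"
    "\<And>xs. c xs \<noteq> 0 \<Longrightarrow> distinct xs \<and> set xs \<in> X \<and> int (length xs) = i + 1"
  shows "c \<in> chains i X"
  using assms by (auto simp: chains_def alternating_def)

lemma zero_chain: "(\<lambda>_. 0) \<in> chains i X"
  by (simp add: chains_def)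

lemma chains_lincomb:
  assumes "c \<in> chains i X" "d \<in> chains i X"
  shows "(\<lambda>xs. a * c xs + b * d xs) \<in> chains i X"
proof (rule chainsI)
  show "finite {xs. a * c xs + b * d xs \<noteq> 0}"
    by (rule finite_subset[of _ "{xs. c xs \<noteq> 0} \<union> {xs. d xs \<noteq> 0}"])
       (use chainsD(1)[OF assms(1)] chainsD(1)[OF assms(2)] in auto)
  show "alternating (\<lambda>xs. a * c xs + b * d xs)"
    using chainsD(2)[OF assms(1)] chainsD(2)[OF assms(2)]
    by (simp add: alternating_def algebra_simps)
  fix xs assume "a * c xs + b * d xs \<noteq> 0"
  then have "c xs \<noteq> 0 \<or> d xs \<noteq> 0" by auto
  then show "distinct xs \<and> set xs \<in> X \<and> int (length xs) = i + 1"
    using chainsD(3-5)[OF assms(1)] chainsD(3-5)[OF assms(2)] by blast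
qed

text \<open>The index set in \<open>boundary\<close> depends on the chain; a common one gives
  linearity.\<close>

lemma boundary_eq_sum:
  assumes "c \<in> chains i X" "X \<subseteq> Pow W" "finite W"
  shows "boundary c xs = (\<Sum>v\<in>W. c (v # xs))"
  unfolding boundary_def
proof (rule sum.mono_neutral_left)
  show "{v. c (v # xs) \<noteq> 0} \<subseteq> W"
    using chainsD(4)[OF assms(1)] assms(2) by fastforce
qed (use assms in auto)

lemma boundary_lincomb:
  assumes "c \<in> chains i X" "d \<in> chains i X" "X \<subseteq> Pow W" "finite W"
  shows "boundary (\<lambda>xs. a * c xs + b * d xs) = (\<lambda>xs. a * boundary c xs + b * boundary d xs)"
  using boundary_eq_sum[OF chains_lincomb[OF assms(1,2)] assms(3,4)]
    boundary_eq_sum[OF assms(1,3,4)] boundary_eq_sum[OF assms(2,3,4)]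
  by (simp add: fun_eq_iff sum.distrib sum_distrib_left)

lemma boundary_chain:
  assumes c: "c \<in> chains (i + 1) X" and X: "\<And>A B. A \<in> X \<Longrightarrow> B \<subseteq> A \<Longrightarrow> B \<in> X"
  shows "boundary c \<in> chains i X"
proof (rule chainsI)
  have ex: "\<exists>v. c (v # xs) \<noteq> 0" if "boundary c xs \<noteq> 0" for xs
    using that unfolding boundary_def by (meson sum.not_neutral_contains_not_neutral)
  have "{xs. boundary c xs \<noteq> 0} \<subseteq> tl ` {xs. c xs \<noteq> 0}"
    using ex by force
  then show "finite {xs. boundary c xs \<noteq> 0}"
    using chainsD(1)[OF c] finite_surj by blast
  show "alternating (boundary c)"
    unfolding alternating_def
  proof (intro allI impI)
    fix xs :: "'a list" and p assume p: "p permutes {..<length xs}"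
    have *: "c (v # permute_list p xs) = real_of_int (sign p) * c (v # xs)" for v
    proof -
      obtain q where "q permutes {..<length (v # xs)}" "sign q = sign p"
        "permute_list q (v # xs) = v # permute_list p xs"
        using permute_list_Cons[OF p] .
      then show ?thesis using alternatingD[OF chainsD(2)[OF c]] by metis
    qed
    show "boundary c (permute_list p xs) = real_of_int (sign p) * boundary c xs"
      unfolding boundary_def * by (simp add: sum_distrib_left sign_def)
  qed
  fix xs assume "boundary c xs \<noteq> 0"
  then obtain v where v: "c (v # xs) \<noteq> 0" using ex by blast
  have "set xs \<in> X" using chainsD(4)[OF c v] by (rule X) auto
  then show "distinct xs \<and> set xs \<in> X \<and> int (length xs) = i + 1"
    using chainsD(3,5)[OF c v] by simp
qed

text \<open>The list enumerates the vertices, the rank compares them. Keeping the rank apart lets a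
  sublist be another instance with the same signs.\<close>

locale vertex_order =
  fixes vs :: "'a list" and r :: "'a \<Rightarrow> nat"
  assumes sorted: "sorted_wrt (\<lambda>x y. r x < r y) vs"
begin

lemma distinct_vs: "distinct vs"
  using sorted by (induction vs) auto

lemma r_eq: "u \<in> set vs \<Longrightarrow> v \<in> set vs \<Longrightarrow> r u = r v \<Longrightarrow> u = v"
  using sorted by (induction vs) auto

sublocale vertex_signs "set vs" "\<lambda>u v. if r u < r v then -1 else 1"
proof
  fix u v assume "u \<in> set vs" "v \<in> set vs" "u \<noteq> v"
  then have "r u \<noteq> r v" using r_eq by blast
  then show "(if r v < r u then -1 else 1) = - (if r u < r v then -1 else 1 :: real)" by auto
qed auto

section \<open>Translation between chains and functions of vertex sets\<close>

definition listing :: "'a set \<Rightarrow> 'a list" where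
  "listing A = filter (\<lambda>x. x \<in> A) vs"

lemma set_listing: "A \<subseteq> set vs \<Longrightarrow> set (listing A) = A"
  by (auto simp: listing_def)

lemma distinct_listing: "distinct (listing A)"
  using distinct_vs by (simp add: listing_def)

lemma length_listing: "A \<subseteq> set vs \<Longrightarrow> length (listing A) = card A"
  using distinct_card[OF distinct_listing] set_listing by metis

text \<open>The vertices of \<open>A\<close> listed before \<open>v\<close> are those contributing
  \<open>-1\<close> to \<open>eps v A\<close>, and moving \<open>v\<close> past each of them is one
  adjacent transposition.\<close>

lemma eps_listing:
  assumes "alternating c" "A \<subseteq> set vs" "v \<in> set vs" "v \<notin> A"
  shows "c (v # listing A) = eps v A * c (listing (insert v A))"
proof -
  obtain ys zs where vs: "vs = ys @ v # zs" using split_list[OF assms(3)] by blast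
  have ord: "u \<in> set ys \<Longrightarrow> r u < r v" "u \<in> set zs \<Longrightarrow> r v < r u" for u
    using sorted unfolding vs by (auto simp: sorted_wrt_append)
  have disj: "v \<notin> set ys" "v \<notin> set zs" "distinct ys" "set ys \<inter> set zs = {}"
    using distinct_vs unfolding vs by auto
  have "listing A = filter (\<lambda>x. x \<in> A) ys @ filter (\<lambda>x. x \<in> A) zs"
    unfolding listing_def unfolding vs using assms(4) by simp
  moreover have "filter (\<lambda>x. x \<in> insert v A) ws = filter (\<lambda>x. x \<in> A) ws" if "v \<notin> set ws" for ws
    using that by (intro filter_cong) auto
  then have "listing (insert v A) = filter (\<lambda>x. x \<in> A) ys @ v # filter (\<lambda>x. x \<in> A) zs"
    unfolding listing_def unfolding vs using disj(1,2) by simp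
  moreover have "eps v A = (-1) ^ length (filter (\<lambda>x. x \<in> A) ys)"
  proof -
    have "finite A" using assms(2) finite_subset by blast
    then have "eps v A = (\<Prod>u\<in>A \<inter> {u. r u < r v}. -1) * (\<Prod>u\<in>A \<inter> - {u. r u < r v}. 1)"
      unfolding eps_def by (rule prod.If_cases)
    moreover have "A \<inter> {u. r u < r v} = set (filter (\<lambda>x. x \<in> A) ys)"
    proof -
      have "u \<in> set ys" if "u \<in> A" "r u < r v" for u
      proof -
        have "u \<in> set vs" using that assms(2) by blast
        then have "u \<in> set ys \<or> u = v \<or> u \<in> set zs" unfolding vs by auto
        then show ?thesis using that assms(4) ord(2)[of u] by auto
      qed
      then show ?thesis using ord(1) by auto
    qed
    ultimately show ?thesis
      using disj(3) by (simp add: distinct_card del: set_filter)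
  qed
  ultimately show ?thesis
    using alternating_move[OF assms(1)] by metis
qed

lemma listing_permutation:
  assumes "distinct xs" "set xs \<subseteq> set vs"
  obtains p where "p permutes {..<length (listing (set xs))}" "permute_list p (listing (set xs)) = xs"
proof -
  have "mset xs = mset (listing (set xs))"
    using assms distinct_listing set_listing by (metis set_eq_iff_mset_eq_distinct)
  then show thesis using mset_eq_permutation that by metis
qed

text \<open>The alternating extension of values prescribed on sorted lists. The chosen permutation
  is unique because a listing has no repetitions.\<close>

definition of_set_fun :: "('a set \<Rightarrow> real) \<Rightarrow> 'a list \<Rightarrow> real" where
  "of_set_fun f xs = (if distinct xs \<and> set xs \<subseteq> set vs
     then real_of_int (sign (SOME p. p permutes {..<length (listing (set xs))} \<and>
       permute_list p (listing (set xs)) = xs)) * f (set xs)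
     else 0)"

definition to_set_fun :: "('a list \<Rightarrow> real) \<Rightarrow> 'a set \<Rightarrow> real" where
  "to_set_fun c A = (if A \<subseteq> set vs then c (listing A) else 0)"

lemma of_set_fun_permute:
  assumes p: "p permutes {..<length (listing A)}" and A: "A \<subseteq> set vs"
  shows "of_set_fun f (permute_list p (listing A)) = real_of_int (sign p) * f A"
proof -
  let ?xs = "permute_list p (listing A)"
  have xs: "distinct ?xs" "set ?xs = A"
    using p A by (simp_all add: distinct_listing set_listing)
  have "(SOME q. q permutes {..<length (listing A)} \<and> permute_list q (listing A) = ?xs) = p"
  proof (rule some_equality)
    fix q assume "q permutes {..<length (listing A)} \<and> permute_list q (listing A) = ?xs"
    then show "q = p" using permute_list_inject[OF distinct_listing _ p] by blast
  qed (use p in simp)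
  then show ?thesis unfolding of_set_fun_def xs(2) using xs(1) A by simp
qed

lemma of_set_fun_listing:
  assumes "A \<subseteq> set vs"
  shows "of_set_fun f (listing A) = f A"
  using of_set_fun_permute[OF permutes_id assms] by simp

lemma alternating_of_set_fun: "alternating (of_set_fun f)"
  unfolding alternating_def
proof (intro allI impI)
  fix xs :: "'a list" and q assume q: "q permutes {..<length xs}"
  show "of_set_fun f (permute_list q xs) = real_of_int (sign q) * of_set_fun f xs"
  proof (cases "distinct xs \<and> set xs \<subseteq> set vs")
    case True
    let ?ys = "listing (set xs)"
    obtain p where p: "p permutes {..<length ?ys}" "permute_list p ?ys = xs"
      using listing_permutation True by blast
    then have "length ?ys = length xs" by (metis length_permute_list)
    then have q': "q permutes {..<length ?ys}" using q by simp
    have "permute_list q xs = permute_list (p \<circ> q) ?ys"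
      using permute_list_compose[OF q'] p(2) by simp
    moreover have "(p \<circ> q) permutes {..<length ?ys}"
      using p(1) q' by (simp add: permutes_compose)
    moreover have "sign (p \<circ> q) = sign p * sign q"
      using p(1) q' by (intro sign_compose) (auto simp: permutation_permutes)
    ultimately show ?thesis
      using of_set_fun_permute[of "p \<circ> q" "set xs" f] of_set_fun_permute[of p "set xs" f] p True
      by simp
  next
    case False
    then show ?thesis using q by (auto simp: of_set_fun_def)
  qed
qed

lemma of_set_fun_chain:
  assumes "\<And>A. f A \<noteq> 0 \<Longrightarrow> A \<in> X \<and> card A = p"
  shows "of_set_fun f \<in> chains (int p - 1) X"
proof (rule chainsI[OF _ alternating_of_set_fun])
  have nz: "distinct xs" "set xs \<subseteq> set vs" "f (set xs) \<noteq> 0" if "of_set_fun f xs \<noteq> 0" for xs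
    using that by (auto simp: of_set_fun_def split: if_splits)
  show "finite {xs. of_set_fun f xs \<noteq> 0}"
    by (rule finite_subset[OF _ finite_subset_distinct[of "set vs"]]) (use nz in auto)
  fix xs assume "of_set_fun f xs \<noteq> 0"
  then show "distinct xs \<and> set xs \<in> X \<and> int (length xs) = int p - 1 + 1"
    using nz[of xs] assms[of "set xs"] distinct_card[of xs] by simp
qed

lemma to_set_fun_chain:
  assumes "c \<in> chains (int p - 1) X" "to_set_fun c A \<noteq> 0"
  shows "A \<in> X" "card A = p"
proof -
  have A: "A \<subseteq> set vs" "c (listing A) \<noteq> 0"
    using assms(2) by (auto simp: to_set_fun_def split: if_splits)
  then show "A \<in> X" "card A = p"
    using chainsD(4,5)[OF assms(1) A(2)] by (simp_all add: set_listing length_listing)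
qed

text \<open>An alternating function is determined by one ordering of each face. Degrees and
  complexes may differ so that comparison with the zero chain is immediate.\<close>

lemma chain_eqI:
  assumes "c \<in> chains i X" "d \<in> chains j Y" "X \<subseteq> Pow (set vs)" "Y \<subseteq> Pow (set vs)"
    and eq: "\<And>A. A \<subseteq> set vs \<Longrightarrow> c (listing A) = d (listing A)"
  shows "c = d"
proof
  fix xs show "c xs = d xs"
  proof (cases "distinct xs \<and> set xs \<subseteq> set vs")
    case True
    then obtain p where p: "p permutes {..<length (listing (set xs))}" "permute_list p (listing (set xs)) = xs"
      using listing_permutation by blast
    show ?thesis
      using alternatingD[OF chainsD(2)[OF assms(1)] p(1)] alternatingD[OF chainsD(2)[OF assms(2)] p(1)]
        eq[of "set xs"] True p(2) by simp
  next
    case False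
    then have "c xs = 0" "d xs = 0"
      using chainsD(3,4)[OF assms(1), of xs] chainsD(3,4)[OF assms(2), of xs] assms(3,4) by blast+
    then show ?thesis by simp
  qed
qed

text \<open>Prepending a vertex of \<open>A\<close> repeats an entry, where a chain vanishes; every
  other prepended vertex is moved to its place by \<open>eps_listing\<close>.\<close>

lemma boundary_listing:
  assumes c: "c \<in> chains i X" and X: "X \<subseteq> Pow U" and U: "U \<subseteq> set vs" and A: "A \<subseteq> set vs"
  shows "boundary c (listing A) = del U (to_set_fun c) A"
proof -
  have fU: "finite U" using U finite_subset by blast
  have "boundary c (listing A) = (\<Sum>v\<in>U. c (v # listing A))"
    using boundary_eq_sum[OF c X fU] .
  also have "\<dots> = (\<Sum>v\<in>U - A. c (v # listing A))"
  proof (rule sum.mono_neutral_right[OF fU])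
    have "c (v # listing A) = 0" if "v \<in> A" for v
      using chainsD(3)[OF c, of "v # listing A"] that set_listing[OF A] by auto
    then show "\<forall>v\<in>U - (U - A). c (v # listing A) = 0" by blast
  qed auto
  also have "\<dots> = del U (to_set_fun c) A"
    unfolding del_def
  proof (rule sum.cong[OF refl])
    fix v assume "v \<in> U - A"
    then have v: "v \<in> set vs" "v \<notin> A" "insert v A \<subseteq> set vs" using U A by auto
    show "c (v # listing A) = eps v A * to_set_fun c (insert v A)"
      using eps_listing[OF chainsD(2)[OF c] A v(1,2)] v(3) by (simp add: to_set_fun_def)
  qed
  finally show ?thesis .
qed

section \<open>Leray numbers\<close>

lemma boundary_boundary:
  assumes c: "c \<in> chains (i + 1 + 1) X" and X: "\<And>A B. A \<in> X \<Longrightarrow> B \<subseteq> A \<Longrightarrow> B \<in> X"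
    and V: "X \<subseteq> Pow (set vs)"
  shows "boundary (boundary c) = (\<lambda>_. 0)"
proof (rule chain_eqI[OF _ zero_chain V V])
  have c1: "boundary c \<in> chains (i + 1) X"
    using c X by (rule boundary_chain)
  show "boundary (boundary c) \<in> chains i X"
    using c1 X by (rule boundary_chain)
  fix A assume A: "A \<subseteq> set vs"
  have "boundary (boundary c) (listing A) = del (set vs) (to_set_fun (boundary c)) A"
    using c1 V subset_refl A by (rule boundary_listing)
  also have "\<dots> = del (set vs) (del (set vs) (to_set_fun c)) A"
  proof (rule del_cong)
    fix v assume "v \<in> set vs - A"
    then have "insert v A \<subseteq> set vs" using A by blast
    then show "to_set_fun (boundary c) (insert v A) = del (set vs) (to_set_fun c) (insert v A)"
      using boundary_listing[OF c V subset_refl] by (simp add: to_set_fun_def)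
  qed
  also have "\<dots> = 0" using A by (intro del_del) auto
  finally show "boundary (boundary c) (listing A) = 0" .
qed

section \<open>The homology group as a quotient of cycles by boundaries\<close>

lemma comm_group_cycle_group:
  assumes V: "X \<subseteq> Pow (set vs)"
  shows "comm_group (cycle_group i X)"
proof (rule comm_groupI)
  note lin = chains_lincomb boundary_lincomb[OF _ _ V finite_set]
  have clos: "(\<lambda>xs. a * c xs + b * d xs) \<in> cycles i X" if "c \<in> cycles i X" "d \<in> cycles i X" for a b c d
    using that lin(1)[of c i X d a b] lin(2)[of c i d a b] by (simp add: cycles_def)
  show "x \<otimes>\<^bsub>cycle_group i X\<^esub> y \<in> carrier (cycle_group i X)"
    if "x \<in> carrier (cycle_group i X)" "y \<in> carrier (cycle_group i X)" for x y
    using clos[of x y 1 1] that by (simp add: cycle_group_def)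
  show "\<one>\<^bsub>cycle_group i X\<^esub> \<in> carrier (cycle_group i X)"
    by (simp add: cycle_group_def cycles_def zero_chain boundary_def)
  show "\<exists>y\<in>carrier (cycle_group i X). y \<otimes>\<^bsub>cycle_group i X\<^esub> x = \<one>\<^bsub>cycle_group i X\<^esub>"
    if "x \<in> carrier (cycle_group i X)" for x
    using clos[of x x "-1" 0] that
    by (intro bexI[of _ "\<lambda>xs. - x xs"]) (simp_all add: cycle_group_def)
qed (simp_all add: cycle_group_def add_ac)

lemma subgroup_boundaries:
  assumes V: "X \<subseteq> Pow (set vs)" and X: "\<And>A B. A \<in> X \<Longrightarrow> B \<subseteq> A \<Longrightarrow> B \<in> X"
  shows "subgroup (boundaries i X) (cycle_group i X)"
proof -
  interpret C: comm_group "cycle_group i X" using V by (rule comm_group_cycle_group)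
  have sub: "boundaries i X \<subseteq> cycles i X"
  proof
    fix b assume "b \<in> boundaries i X"
    then obtain c where c: "c \<in> chains (i + 1) X" "b = boundary c"
      by (auto simp: boundaries_def)
    have "boundary b = (\<lambda>_. 0)"
      using boundary_boundary[of c "i - 1", OF _ X V] c by simp
    moreover have "b \<in> chains i X"
      unfolding c(2) using c(1) X by (rule boundary_chain)
    ultimately show "b \<in> cycles i X" by (simp add: cycles_def)
  qed
  have clos: "(\<lambda>xs. a * x xs + b * y xs) \<in> boundaries i X"
    if xy: "x \<in> boundaries i X" "y \<in> boundaries i X" for a b x y
  proof -
    obtain c d where "c \<in> chains (i + 1) X" "d \<in> chains (i + 1) X" "x = boundary c" "y = boundary d"
      using xy by (auto simp: boundaries_def)
    then show ?thesis
      unfolding boundaries_def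
      by (intro image_eqI[of _ _ "\<lambda>xs. a * c xs + b * d xs"])
         (simp_all add: chains_lincomb boundary_lincomb[OF _ _ V finite_set])
  qed
  show ?thesis
  proof (rule C.subgroupI)
    show "boundaries i X \<subseteq> carrier (cycle_group i X)"
      using sub by (simp add: cycle_group_def)
    show "boundaries i X \<noteq> {}"
      using zero_chain by (auto simp: boundaries_def)
  next
    fix x assume x: "x \<in> boundaries i X"
    have m: "(\<lambda>xs. - x xs) \<in> boundaries i X" using clos[OF x x, of "-1" 0] by simp
    have "inv\<^bsub>cycle_group i X\<^esub> x = (\<lambda>xs. - x xs)"
      using x m sub by (intro C.inv_equality) (auto simp: cycle_group_def)
    then show "inv\<^bsub>cycle_group i X\<^esub> x \<in> boundaries i X" using m by simp
  next
    fix x y assume "x \<in> boundaries i X" "y \<in> boundaries i X"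
    then show "x \<otimes>\<^bsub>cycle_group i X\<^esub> y \<in> boundaries i X"
      using clos[of x y 1 1] by (simp add: cycle_group_def)
  qed
qed

lemma trivial_reduced_homology_iff:
  assumes V: "X \<subseteq> Pow (set vs)" and X: "\<And>A B. A \<in> X \<Longrightarrow> B \<subseteq> A \<Longrightarrow> B \<in> X"
  shows "trivial_group (reduced_homology_group i X) \<longleftrightarrow> cycles i X \<subseteq> boundaries i X"
proof -
  interpret C: comm_group "cycle_group i X" using V by (rule comm_group_cycle_group)
  have sub: "subgroup (boundaries i X) (cycle_group i X)"
    using V X by (rule subgroup_boundaries)
  \<comment> \<open>\<open>trivial_group\<close> also asserts the group axioms of the
    quotient.\<close>
  have grp: "group (reduced_homology_group i X)"
    unfolding reduced_homology_group_def
    using C.abelian_FactGroup[OF sub] by (rule comm_group.axioms(2))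
  have car: "carrier (cycle_group i X) = cycles i X" by (simp add: cycle_group_def)
  have carH: "carrier (reduced_homology_group i X) =
      (\<lambda>x. boundaries i X #>\<^bsub>cycle_group i X\<^esub> x) ` cycles i X"
    by (simp add: reduced_homology_group_def carrier_FactGroup car)
  have oneH: "\<one>\<^bsub>reduced_homology_group i X\<^esub> = boundaries i X"
    by (simp add: reduced_homology_group_def)
  show ?thesis
  proof
    assume "trivial_group (reduced_homology_group i X)"
    then have *: "carrier (reduced_homology_group i X) = {boundaries i X}"
      using oneH by (simp add: trivial_group_def)
    show "cycles i X \<subseteq> boundaries i X"
    proof
      fix x assume x: "x \<in> cycles i X"
      then have "boundaries i X #>\<^bsub>cycle_group i X\<^esub> x = boundaries i X"
        using * carH by blast
      then show "x \<in> boundaries i X"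
        using C.coset_join1[OF _ _ sub] x car by blast
    qed
  next
    assume le: "cycles i X \<subseteq> boundaries i X"
    have "boundaries i X #>\<^bsub>cycle_group i X\<^esub> x = boundaries i X" if "x \<in> cycles i X" for x
      using C.coset_join2[OF _ sub] that le car by blast
    then have "carrier (reduced_homology_group i X) \<subseteq> {\<one>\<^bsub>reduced_homology_group i X\<^esub>}"
      unfolding carH oneH by blast
    then show "trivial_group (reduced_homology_group i X)"
      using group.trivial_group_subset[OF grp] by blast
  qed
qed

lemma homology_vanishes_iff:
  assumes U: "U \<subseteq> set vs" and X: "\<And>A B. A \<in> X \<Longrightarrow> B \<subseteq> A \<Longrightarrow> B \<in> X"
  shows "trivial_group (reduced_homology_group (int p - 1) (induced_subcomplex X U)) \<longleftrightarrow>
    homology_vanishes U X p"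
proof -
  define Y where "Y = induced_subcomplex X U"
  have Y_iff: "A \<in> Y \<longleftrightarrow> A \<in> X \<and> A \<subseteq> U" for A by (simp add: Y_def induced_subcomplex_def)
  have YU: "Y \<subseteq> Pow U" by (auto simp: Y_iff)
  then have YV: "Y \<subseteq> Pow (set vs)" using U by blast
  have Y: "B \<in> Y" if "A \<in> Y" "B \<subseteq> A" for A B using X[of A B] that by (auto simp: Y_iff)
  \<comment> \<open>\<open>del U\<close> is controlled on subsets of \<open>U\<close> only, whereas
    equality of chains is tested on all listings.\<close>
  have off: "c (listing A) = 0" if "c \<in> chains j Y" "A \<subseteq> set vs" "\<not> A \<subseteq> U" for c j A
    using chainsD(4)[OF that(1), of "listing A"] that(2,3) YU by (auto simp: set_listing)
  have sp: "int (Suc p) - 1 = int p - 1 + 1" by simp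
  have "cycles (int p - 1) Y \<subseteq> boundaries (int p - 1) Y \<longleftrightarrow> homology_vanishes U X p"
  proof
    assume le: "cycles (int p - 1) Y \<subseteq> boundaries (int p - 1) Y"
    show "homology_vanishes U X p"
      unfolding homology_vanishes_def
    proof (intro allI impI)
      fix z assume z: "\<forall>A. z A \<noteq> 0 \<longrightarrow> A \<subseteq> U \<and> A \<in> X \<and> card A = p" and dz: "\<forall>A\<subseteq>U. del U z A = 0"
      define c where "c = of_set_fun z"
      have c: "c \<in> chains (int p - 1) Y"
        unfolding c_def using z Y_iff by (intro of_set_fun_chain) auto
      have "boundary c = (\<lambda>_. 0)"
      proof (rule chain_eqI[OF _ zero_chain YV YV])
        show bc: "boundary c \<in> chains (int p - 1 - 1) Y"
          by (rule boundary_chain) (use c Y in auto)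
        fix A assume A: "A \<subseteq> set vs"
        show "boundary c (listing A) = 0"
        proof (cases "A \<subseteq> U")
          case True
          have "boundary c (listing A) = del U (to_set_fun c) A"
            using c YU U A by (rule boundary_listing)
          also have "\<dots> = del U z A"
          proof (rule del_cong)
            fix v assume "v \<in> U - A"
            then have "insert v A \<subseteq> set vs" using U A by blast
            then show "to_set_fun c (insert v A) = z (insert v A)"
              by (simp add: to_set_fun_def c_def of_set_fun_listing)
          qed
          finally show ?thesis using dz True by simp
        qed (use off[OF bc A] in blast)
      qed
      then have "c \<in> cycles (int p - 1) Y" using c by (simp add: cycles_def)
      then obtain d where d: "d \<in> chains (int p - 1 + 1) Y" "c = boundary d"
        using le by (auto simp: boundaries_def)
      have "A \<subseteq> U \<and> A \<in> X \<and> card A = Suc p" if "to_set_fun d A \<noteq> 0" for A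
        using to_set_fun_chain[of d "Suc p" Y A] d(1) that Y_iff unfolding sp by blast
      moreover have "del U (to_set_fun d) A = z A" if "A \<subseteq> U" for A
      proof -
        have A: "A \<subseteq> set vs" using that U by blast
        have "del U (to_set_fun d) A = boundary d (listing A)"
          using boundary_listing[OF d(1) YU U A] by simp
        then show ?thesis using of_set_fun_listing[OF A, of z] by (simp only: d(2)[symmetric] c_def)
      qed
      ultimately show "\<exists>g. (\<forall>A. g A \<noteq> 0 \<longrightarrow> A \<subseteq> U \<and> A \<in> X \<and> card A = Suc p) \<and> (\<forall>A\<subseteq>U. del U g A = z A)"
        by blast
    qed
  next
    assume van: "homology_vanishes U X p"
    show "cycles (int p - 1) Y \<subseteq> boundaries (int p - 1) Y"
    proof
      fix c assume "c \<in> cycles (int p - 1) Y"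
      then have c: "c \<in> chains (int p - 1) Y" "boundary c = (\<lambda>_. 0)" by (auto simp: cycles_def)
      define z where "z = to_set_fun c"
      have z: "A \<subseteq> U \<and> A \<in> X \<and> card A = p" if "z A \<noteq> 0" for A
        using to_set_fun_chain[OF c(1)] that Y_iff by (auto simp: z_def)
      have dz: "del U z A = 0" if "A \<subseteq> U" for A
      proof -
        have A: "A \<subseteq> set vs" using that U by blast
        show ?thesis using boundary_listing[OF c(1) YU U A] c(2) by (simp add: z_def)
      qed
      obtain g where g: "\<forall>A. g A \<noteq> 0 \<longrightarrow> A \<subseteq> U \<and> A \<in> X \<and> card A = Suc p" "\<forall>A\<subseteq>U. del U g A = z A"
        using van[unfolded homology_vanishes_def, rule_format, of z] z dz by auto
      define d where "d = of_set_fun g"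
      have d: "d \<in> chains (int p - 1 + 1) Y"
        unfolding d_def sp[symmetric] using g(1) Y_iff by (intro of_set_fun_chain) auto
      have "boundary d = c"
      proof (rule chain_eqI[OF _ c(1) YV YV])
        show bd: "boundary d \<in> chains (int p - 1) Y"
          by (rule boundary_chain) (use d Y in auto)
        fix A assume A: "A \<subseteq> set vs"
        show "boundary d (listing A) = c (listing A)"
        proof (cases "A \<subseteq> U")
          case True
          have "boundary d (listing A) = del U (to_set_fun d) A"
            using d YU U A by (rule boundary_listing)
          also have "\<dots> = del U g A"
          proof (rule del_cong)
            fix v assume "v \<in> U - A"
            then have "insert v A \<subseteq> set vs" using U A by blast
            then show "to_set_fun d (insert v A) = g (insert v A)"
              by (simp add: to_set_fun_def d_def of_set_fun_listing)
          qed
          finally show ?thesis using g(2) True A by (simp add: z_def to_set_fun_def)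
        qed (use off[OF bd A] off[OF c(1) A] in simp)
      qed
      then show "c \<in> boundaries (int p - 1) Y" using d by (auto simp: boundaries_def)
    qed
  qed
  then show ?thesis
    using trivial_reduced_homology_iff[OF YV Y] by (simp add: Y_def)
qed

text \<open>Without vertices there is no cone apex. The only possible face is \<open>{}\<close>,
  which is a cycle of size \<open>0\<close> and bounds nothing.\<close>

lemma homology_vanishes_empty: "homology_vanishes {} X p \<longleftrightarrow> \<not> ({} \<in> X \<and> p = 0)"
proof
  assume van: "homology_vanishes {} X p"
  show "\<not> ({} \<in> X \<and> p = 0)"
  proof
    assume *: "{} \<in> X \<and> p = 0"
    define z :: "'a set \<Rightarrow> real" where "z = (\<lambda>A. if A = {} then 1 else 0)"
    have supp: "\<forall>A. z A \<noteq> 0 \<longrightarrow> A \<subseteq> {} \<and> A \<in> X \<and> card A = p"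
      using * by (simp add: z_def)
    have "\<forall>A\<subseteq>{}. del {} z A = 0" by (simp add: del_def)
    then obtain g where "\<forall>A\<subseteq>{}. del {} g A = z A"
      using van[unfolded homology_vanishes_def, THEN spec, THEN mp, OF supp] by blast
    then have "del {} g {} = z {}" by blast
    then show False by (simp add: z_def del_def)
  qed
next
  assume X: "\<not> ({} \<in> X \<and> p = 0)"
  have zero: "z A = 0" if z: "\<forall>A. z A \<noteq> 0 \<longrightarrow> A \<subseteq> {} \<and> A \<in> X \<and> card A = p"
    for z :: "'a set \<Rightarrow> real" and A
  proof (rule ccontr)
    assume "z A \<noteq> 0"
    then have "A \<subseteq> {}" "A \<in> X" "card A = p" using z by blast+
    then show False using X by simp
  qed
  show "homology_vanishes {} X p"
    unfolding homology_vanishes_def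
  proof (intro allI impI)
    fix z :: "'a set \<Rightarrow> real"
    assume "\<forall>A. z A \<noteq> 0 \<longrightarrow> A \<subseteq> {} \<and> A \<in> X \<and> card A = p"
    then have "z A = 0" for A by (rule zero)
    then show "\<exists>g. (\<forall>A. g A \<noteq> 0 \<longrightarrow> A \<subseteq> {} \<and> A \<in> X \<and> card A = Suc p) \<and> (\<forall>A\<subseteq>{}. del {} g A = z A)"
      by (intro exI[of _ "\<lambda>_. 0"]) (simp add: del_def)
  qed
qed

section \<open>Leray numbers through harmonic functions\<close>

lemma homology_vanishes_iff_harmonic:
  assumes "U \<subseteq> set vs" "U \<noteq> {}" "\<And>A B. A \<in> X \<Longrightarrow> B \<subseteq> A \<Longrightarrow> B \<in> X"
  shows "homology_vanishes U X p \<longleftrightarrow> \<not> (\<exists>h A. harmonic U (- X) h \<and> h A \<noteq> 0 \<and> card A = Suc p)"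
proof -
  obtain u where "u \<in> U" using assms(2) by blast
  moreover have "\<exists>h A. harmonic U (- X) h \<and> h A \<noteq> 0 \<and> card A = Suc p"
    if "u \<in> U" "\<not> homology_vanishes U X p" for u
    by (rule not_homology_vanishes_imp_harmonic[OF assms(1) that(1) _ that(2)]) (rule assms(3))
  ultimately show ?thesis
    using harmonic_imp_not_homology_vanishes[OF assms(1)] by blast
qed

text \<open>A size \<open>k = Suc p\<close> witnesses homology in degree
  \<open>p - 1 = k - 2\<close>, which has to lie below \<open>d\<close>.\<close>

lemma Leray_iff:
  assumes X: "\<And>A B. A \<in> X \<Longrightarrow> B \<subseteq> A \<Longrightarrow> B \<in> X" and V: "set vs \<notin> X" and d: "d \<ge> -1"
  shows "Leray d (set vs) X \<longleftrightarrow> (\<forall>k\<in>harmonic_cards (set vs) (- X). int k \<le> d + 1)"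
proof -
  have hv: "trivial_group (reduced_homology_group (int p - 1) (induced_subcomplex X U)) \<longleftrightarrow>
      homology_vanishes U X p" if "U \<subseteq> set vs" for U p
    by (rule homology_vanishes_iff[OF that]) (rule X)
  have hh: "homology_vanishes U X p \<longleftrightarrow> \<not> (\<exists>h A. harmonic U (- X) h \<and> h A \<noteq> 0 \<and> card A = Suc p)"
    if "U \<subseteq> set vs" "U \<noteq> {}" for U p
    by (rule homology_vanishes_iff_harmonic[OF that]) (rule X)
  show ?thesis
  proof
    assume L: "Leray d (set vs) X"
    show "\<forall>k\<in>harmonic_cards (set vs) (- X). int k \<le> d + 1"
    proof
      fix k assume "k \<in> harmonic_cards (set vs) (- X)"
      then obtain U h A where U: "U \<subseteq> set vs" "harmonic U (- X) h" "h A \<noteq> 0" "k = card A"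
        by (auto simp: harmonic_cards_def)
      show "int k \<le> d + 1"
      \<comment> \<open>The size \<open>0\<close> witnesses no homology; there the bound holds
        because \<open>d \<ge> -1\<close>.\<close>
      proof (cases k)
        case (Suc p)
        then have "A \<noteq> {}" using U(4) by auto
        then have "U \<noteq> {}" using U(2,3) by (auto simp: harmonic_def)
        then have "\<not> homology_vanishes U X p"
          using U Suc hh[OF U(1)] by metis
        then have "\<not> trivial_group (reduced_homology_group (int p - 1) (induced_subcomplex X U))"
          using hv[OF U(1)] by simp
        then have "\<not> int p - 1 \<ge> d"
          using L U(1) unfolding Leray_def by blast
        then show ?thesis using Suc by simp
      qed (use d in simp)
    qed
  next
    assume le: "\<forall>k\<in>harmonic_cards (set vs) (- X). int k \<le> d + 1"
    show "Leray d (set vs) X"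
      unfolding Leray_def
    proof (intro allI impI)
      fix U i assume U: "U \<subseteq> set vs" and i: "d \<le> i"
      define p where "p = nat (i + 1)"
      have p: "i = int p - 1" using i d by (simp add: p_def)
      have "homology_vanishes U X p"
      proof (cases "U = {}")
        case True
        \<comment> \<open>If \<open>{}\<close> is a face, a minimal nonface is nonempty and its size
          excludes \<open>d = -1\<close>.\<close>
        have False if "{} \<in> X" "p = 0"
        proof -
          obtain M where M: "M \<in> - X" "M \<subseteq> set vs" "card M \<in> harmonic_cards (set vs) (- X)"
            using harmonic_cards_minimal[of "set vs" "- X"] V by auto
          then have "int (card M) \<le> 0" using le i p that by fastforce
          then have "M = {}" using M(2) finite_subset by fastforce
          then show False using M(1) that by simp
        qed
        then show ?thesis using homology_vanishes_empty True by blast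
      next
        case False
        have "card A \<noteq> Suc p" if "harmonic U (- X) h" "h A \<noteq> 0" for h A
        proof -
          have "int (card A) \<le> d + 1" using le harmonic_cardsI[OF that(1) U that(2)] by blast
          then show ?thesis using i p by linarith
        qed
        then show ?thesis using hh[OF U False] by blast
      qed
      then show "trivial_group (reduced_homology_group i (induced_subcomplex X U))"
        using hv[OF U] p by simp
    qed
  qed
qed

lemma Leray_number_eq:
  assumes X: "\<And>A B. A \<in> X \<Longrightarrow> B \<subseteq> A \<Longrightarrow> B \<in> X" and V: "set vs \<notin> X"
  shows "Leray_number (set vs) X = int (Max (harmonic_cards (set vs) (- X))) - 1"
proof -
  let ?K = "harmonic_cards (set vs) (- X)"
  have fin: "finite ?K" by (rule finite_harmonic_cards) simp
  have ne: "?K \<noteq> {}" using harmonic_cards_minimal[of "set vs" "- X"] V by auto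
  \<comment> \<open>\<open>Max ?K\<close> is a natural number, so the right-hand side already
    implies \<open>d \<ge> -1\<close>.\<close>
  have "d \<ge> -1 \<and> Leray d (set vs) X \<longleftrightarrow> int (Max ?K) - 1 \<le> d" for d
  proof -
    have "(\<forall>k\<in>?K. int k \<le> d + 1) \<longleftrightarrow> int (Max ?K) \<le> d + 1"
    proof
      assume "int (Max ?K) \<le> d + 1"
      then show "\<forall>k\<in>?K. int k \<le> d + 1"
        using Max_ge[OF fin] by (meson of_nat_mono order_trans)
    qed (use Max_in[OF fin ne] in blast)
    moreover have "Leray d (set vs) X \<longleftrightarrow> (\<forall>k\<in>?K. int k \<le> d + 1)" if "d \<ge> -1"
      by (rule Leray_iff[OF _ V that]) (rule X)
    ultimately show ?thesis by auto
  qed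
  then show ?thesis
    unfolding Leray_number_def by (intro Least_equality) auto
qed

lemma Leray_number_eq_subset:
  assumes "W \<subseteq> set vs" "\<And>A B. A \<in> X \<Longrightarrow> B \<subseteq> A \<Longrightarrow> B \<in> X" "W \<notin> X"
  shows "Leray_number W X = int (Max (harmonic_cards W (- X))) - 1"
proof -
  \<comment> \<open>The sublist keeps the rank \<open>r\<close>, so \<open>harmonic_cards\<close>
    uses the same signs in both interpretations.\<close>
  interpret W: vertex_order "listing W" r
    by unfold_locales (simp add: listing_def sorted sorted_wrt_filter)
  have "Leray_number (set (listing W)) X = int (Max (harmonic_cards (set (listing W)) (- X))) - 1"
    by (rule W.Leray_number_eq) (use assms set_listing in auto)
  then show ?thesis using assms(1) by (simp add: set_listing)
qed

end

lemma vertex_order_exists: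
  assumes "finite V"
  obtains vs r where "vertex_order vs r" "set vs = V"
proof -
  obtain xs where xs: "set xs = V" "distinct xs" using finite_distinct_list[OF assms] by blast
  obtain r :: "'a \<Rightarrow> nat" where r: "inj_on r V" using finite_imp_inj_to_nat_seg[OF assms] by blast
  have "distinct (map r (sort_key r xs))" using xs r by (simp add: distinct_map)
  then have "sorted_wrt (<) (map r (sort_key r xs))" by (simp add: strict_sorted_iff)
  then have "vertex_order (sort_key r xs) r" by unfold_locales (simp add: sorted_wrt_map)
  then show thesis using that xs by simp
qed

section \<open>Independence numbers\<close>

lemma independent_set_induce:
  "independent_set (G \<restriction> U) S \<longleftrightarrow> S \<subseteq> U \<and> (\<forall>u\<in>S. \<forall>v\<in>S. \<not> u \<rightarrow>\<^bsub>G\<^esub> v)"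
proof -
  have "arcs_ends (G \<restriction> U) = {(u, v). u \<rightarrow>\<^bsub>G\<^esub> v \<and> u \<in> U \<and> v \<in> U}"
    by (auto simp: arcs_ends_conv)
  then show ?thesis
    unfolding independent_set_def induce_subgraph_verts by blast
qed

lemma finite_independent_cards:
  assumes "finite (verts G)"
  shows "finite {card S |S. independent_set G S}"
  by (rule finite_subset[of _ "{..card (verts G)}"])
     (use assms in \<open>auto simp: independent_set_def card_mono\<close>)

lemma card_le_independence_number:
  assumes "finite (verts G)" "independent_set G S"
  shows "card S \<le> independence_number G"
  unfolding independence_number_def
  using assms by (intro Max_ge finite_independent_cards) auto

lemma independence_number_attained:
  assumes "finite (verts G)"
  obtains S where "independent_set G S" "card S = independence_number G"
proof -
  have "independent_set G {}" by (simp add: independent_set_def)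
  then have "{card S |S. independent_set G S} \<noteq> {}" by blast
  then have "independence_number G \<in> {card S |S. independent_set G S}"
    unfolding independence_number_def by (rule Max_in[OF finite_independent_cards[OF assms]])
  then show thesis using that by auto
qed

lemma independence_number_induce_mono:
  assumes "finite W" "U \<subseteq> W"
  shows "independence_number (G \<restriction> U) \<le> independence_number (G \<restriction> W)"
proof -
  obtain S where S: "independent_set (G \<restriction> U) S" "card S = independence_number (G \<restriction> U)"
    using independence_number_attained[of "G \<restriction> U"] finite_subset[OF assms(2,1)] by auto
  then have "independent_set (G \<restriction> W) S" using assms(2) by (auto simp: independent_set_induce)
  then show ?thesis using card_le_independence_number[of "G \<restriction> W" S] S(2) assms(1) by simp
qed

lemma independence_number_induce_verts: "independence_number (G \<restriction> verts G) = independence_number G"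
  by (simp add: independence_number_def independent_set_induce) (simp add: independent_set_def)

text \<open>No arc joins two components: the traces of an independent set are independent, and
  independent sets chosen in the components have an independent union.\<close>

lemma independence_number_disjoint_union:
  fixes G :: "'i \<Rightarrow> 'a pair_pre_digraph"
  assumes I: "finite I" and G: "\<And>i. i \<in> I \<Longrightarrow> pair_fin_digraph (G i)"
    and disj: "disjoint_family_on (\<lambda>i. pverts (G i)) I"
    and H: "parcs H = (\<Union>i\<in>I. parcs (G i))" and U: "U \<subseteq> (\<Union>i\<in>I. pverts (G i))"
  shows "independence_number (with_proj H \<restriction> U) =
    (\<Sum>i\<in>I. independence_number (with_proj (G i) \<restriction> (U \<inter> pverts (G i))))"
proof -
  let ?V = "\<lambda>i. pverts (G i)"
  have finV: "finite (?V i)" if "i \<in> I" for i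
    using G[OF that] by (rule pair_fin_digraph.pair_finite_verts)
  then have finU: "finite U" using finite_subset[OF U] I by blast
  have ends: "u \<in> ?V i" "v \<in> ?V i" if "(u, v) \<in> parcs (G i)" "i \<in> I" for u v i
  proof -
    interpret pair_fin_digraph "G i" using G[OF that(2)] .
    show "u \<in> ?V i" "v \<in> ?V i" using that(1) by (auto dest: in_arcsD1 in_arcsD2)
  qed
  have same: "i = j" if "u \<in> ?V i" "u \<in> ?V j" "i \<in> I" "j \<in> I" for u i j
    using disj that by (auto simp: disjoint_family_on_def)
  show ?thesis
  proof (rule antisym)
    obtain S where S: "independent_set (with_proj H \<restriction> U) S" "card S = independence_number (with_proj H \<restriction> U)"
      using independence_number_attained[of "with_proj H \<restriction> U"] finU by auto
    have SU: "S \<subseteq> U" and SH: "\<And>u v. u \<in> S \<Longrightarrow> v \<in> S \<Longrightarrow> (u, v) \<notin> parcs H"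
      using S(1) by (auto simp: independent_set_induce)
    have "S = (\<Union>i\<in>I. S \<inter> ?V i)" using SU U by blast
    then have "card S = card (\<Union>i\<in>I. S \<inter> ?V i)" by simp
    also have "\<dots> = (\<Sum>i\<in>I. card (S \<inter> ?V i))"
      by (rule card_UN_disjoint[OF I]) (use finV same in blast)+
    also have "\<dots> \<le> (\<Sum>i\<in>I. independence_number (with_proj (G i) \<restriction> (U \<inter> ?V i)))"
    proof (rule sum_mono)
      fix i assume i: "i \<in> I"
      have "independent_set (with_proj (G i) \<restriction> (U \<inter> ?V i)) (S \<inter> ?V i)"
        using SU SH i by (auto simp: independent_set_induce H)
      then show "card (S \<inter> ?V i) \<le> independence_number (with_proj (G i) \<restriction> (U \<inter> ?V i))"
        using finU by (intro card_le_independence_number) auto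
    qed
    finally show "independence_number (with_proj H \<restriction> U) \<le>
        (\<Sum>i\<in>I. independence_number (with_proj (G i) \<restriction> (U \<inter> ?V i)))"
      unfolding S(2) .
  next
    have "\<exists>S. independent_set (with_proj (G i) \<restriction> (U \<inter> ?V i)) S \<and>
        card S = independence_number (with_proj (G i) \<restriction> (U \<inter> ?V i))" for i
      using independence_number_attained[of "with_proj (G i) \<restriction> (U \<inter> ?V i)"] finU by auto
    then obtain S where S: "\<And>i. independent_set (with_proj (G i) \<restriction> (U \<inter> ?V i)) (S i)"
      "\<And>i. card (S i) = independence_number (with_proj (G i) \<restriction> (U \<inter> ?V i))" by metis
    have SV: "S i \<subseteq> U" "S i \<subseteq> ?V i" and SG: "\<And>u v. u \<in> S i \<Longrightarrow> v \<in> S i \<Longrightarrow> (u, v) \<notin> parcs (G i)" for i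
      using S(1)[of i] by (auto simp: independent_set_induce)
    have "(u, v) \<notin> parcs H" if u: "u \<in> S i" "i \<in> I" and v: "v \<in> S j" "j \<in> I" for u v i j
    proof
      assume "(u, v) \<in> parcs H"
      then obtain k where k: "k \<in> I" "(u, v) \<in> parcs (G k)" using H by blast
      then have "u \<in> ?V k" "v \<in> ?V k" using ends by blast+
      moreover have "u \<in> ?V i" "v \<in> ?V j" using u v SV by blast+
      ultimately have "i = k" "j = k" using same k(1) u(2) v(2) by blast+
      then show False using SG[of u k v] u(1) v(1) k(2) by simp
    qed
    then have "independent_set (with_proj H \<restriction> U) (\<Union>i\<in>I. S i)"
      using SV(1) by (fastforce simp: independent_set_induce)
    then have "card (\<Union>i\<in>I. S i) \<le> independence_number (with_proj H \<restriction> U)"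
      using finU by (intro card_le_independence_number) auto
    moreover have "card (\<Union>i\<in>I. S i) = (\<Sum>i\<in>I. card (S i))"
    proof (rule card_UN_disjoint[OF I])
      show "\<forall>i\<in>I. finite (S i)" using SV(1) finU finite_subset by blast
      show "\<forall>i\<in>I. \<forall>j\<in>I. i \<noteq> j \<longrightarrow> S i \<inter> S j = {}" using SV(2) same by blast
    qed
    ultimately show "(\<Sum>i\<in>I. independence_number (with_proj (G i) \<restriction> (U \<inter> ?V i))) \<le>
        independence_number (with_proj H \<restriction> U)"
      by (simp add: S(2))
  qed
qed

lemma I_complex_subset:
  assumes "finite (verts G)" "A \<in> I_complex n G" "B \<subseteq> A"
  shows "B \<in> I_complex n G"
proof -
  have "finite A" using assms(1,2) finite_subset by (auto simp: I_complex_def)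
  then have "independence_number (G \<restriction> B) \<le> independence_number (G \<restriction> A)"
    using assms(3) by (rule independence_number_induce_mono)
  then show ?thesis using assms(2,3) by (auto simp: I_complex_def)
qed

theorem theorem7p3:
  fixes m :: nat
    and G :: "nat \<Rightarrow> 'a pair_pre_digraph"
    and H :: "'a pair_pre_digraph"
    and t :: "nat \<Rightarrow> nat"
    and l :: "nat \<Rightarrow> int"
  assumes "\<And>i. i \<in> {1..m} \<Longrightarrow> pair_graph (G i)"
    and "disjoint_family_on (\<lambda>i. pverts (G i)) {1..m}"
    and "H = \<lparr>pverts = (\<Union>i\<in>{1..m}. pverts (G i)), parcs = (\<Union>i\<in>{1..m}. parcs (G i))\<rparr>"
    and "\<And>i. i \<in> {1..m} \<Longrightarrow> t i = independence_number (with_proj (G i))"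
    and "\<And>i. i \<in> {1..m} \<Longrightarrow>
           l i = Leray_number (pverts (G i)) (I_complex (t i) (with_proj (G i)))"
  shows "(\<Sum>i\<in>{1..m}. t i) = independence_number (with_proj H) \<and>
         Leray_number (pverts H) (I_complex (\<Sum>i\<in>{1..m}. t i) (with_proj H))
           = (\<Sum>i\<in>{1..m}. l i) + int m - 1"
proof -
  let ?I = "{1..m}" and ?T = "\<Sum>i\<in>{1..m}. t i"
  define W where "W = (\<lambda>i. pverts (G i))"
  define X where "X = (\<lambda>i. I_complex (t i) (with_proj (G i)))"
  define \<alpha> where "\<alpha> = (\<lambda>i U. independence_number (with_proj (G i) \<restriction> (U \<inter> W i)))"
  have pH: "pverts H = (\<Union>i\<in>?I. W i)" "parcs H = (\<Union>i\<in>?I. parcs (G i))"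
    using assms(3) by (simp_all add: W_def)
  have G: "pair_fin_digraph (G i)" if "i \<in> ?I" for i
    using assms(1)[OF that] by (simp add: pair_graph_def pair_digraph_def)
  have finW: "finite (W i)" if "i \<in> ?I" for i
    unfolding W_def using G[OF that] by (rule pair_fin_digraph.pair_finite_verts)
  then have finH: "finite (pverts H)" by (simp add: pH)
  have \<alpha>_sum: "independence_number (with_proj H \<restriction> U) = (\<Sum>i\<in>?I. \<alpha> i U)" if "U \<subseteq> pverts H" for U
    unfolding \<alpha>_def W_def using G assms(2) pH(2) that[unfolded pH(1) W_def]
    by (intro independence_number_disjoint_union) auto
  have t_eq: "independence_number (with_proj (G i) \<restriction> W i) = t i" if "i \<in> ?I" for i
    using independence_number_induce_verts[of "with_proj (G i)"] assms(4)[OF that] by (simp add: W_def)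
  have \<alpha>_le: "\<alpha> i U \<le> t i" if "i \<in> ?I" for i U
    unfolding \<alpha>_def t_eq[OF that, symmetric] using finW[OF that] by (intro independence_number_induce_mono) auto
  have "\<alpha> i (pverts H) = t i" if "i \<in> ?I" for i
  proof -
    have "pverts H \<inter> W i = W i" using that by (auto simp: pH)
    then show ?thesis using t_eq[OF that] by (simp add: \<alpha>_def)
  qed
  then have first: "?T = independence_number (with_proj H)"
    using \<alpha>_sum[OF subset_refl] independence_number_induce_verts[of "with_proj H"] by simp
  have X_iff: "U \<inter> W i \<in> X i \<longleftrightarrow> \<alpha> i U < t i" for i U
    by (auto simp: X_def I_complex_def \<alpha>_def W_def)
  have nonface: "U \<in> - I_complex ?T (with_proj H) \<longleftrightarrow> U \<in> {A. \<forall>i\<in>?I. A \<inter> W i \<in> - X i}"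
    if U: "U \<subseteq> pverts H" for U
  proof -
    \<comment> \<open>Each summand is bounded by \<open>t i\<close>, so the sum falls short of
      \<open>?T\<close> exactly when some summand does. This is where the threshold of every complex
      has to be the full independence number.\<close>
    have "(\<Sum>i\<in>?I. \<alpha> i U) < ?T \<longleftrightarrow> (\<exists>i\<in>?I. \<alpha> i U < t i)"
    proof
      assume "(\<Sum>i\<in>?I. \<alpha> i U) < ?T"
      then show "\<exists>i\<in>?I. \<alpha> i U < t i" by (meson not_le sum_mono)
    next
      assume "\<exists>i\<in>?I. \<alpha> i U < t i"
      then show "(\<Sum>i\<in>?I. \<alpha> i U) < ?T" using \<alpha>_le by (intro sum_strict_mono_ex1) auto
    qed
    then show ?thesis using U \<alpha>_sum[OF U] X_iff by (auto simp: I_complex_def)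
  qed
  \<comment> \<open>One vertex order of \<open>H\<close> serves all components, so that their
    harmonic functions share the same signs.\<close>
  obtain vs r where "vertex_order vs r" and vs: "set vs = pverts H"
    using vertex_order_exists[OF finH] by blast
  then interpret vertex_order vs r by simp
  have WV: "W i \<subseteq> set vs" if "i \<in> ?I" for i using that by (auto simp: vs pH)
  have WX: "W i \<in> - X i" if "i \<in> ?I" for i
    using t_eq[OF that] by (simp add: X_def I_complex_def)
  have down: "B \<in> X i" if "i \<in> ?I" "A \<in> X i" "B \<subseteq> A" for i A B
  proof -
    have "finite (verts (with_proj (G i)))" using finW[OF that(1)] by (simp add: W_def)
    moreover have "A \<in> I_complex (t i) (with_proj (G i))" using that(2) by (simp add: X_def)
    ultimately have "B \<in> I_complex (t i) (with_proj (G i))" using that(3) by (rule I_complex_subset)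
    then show ?thesis by (simp add: X_def)
  qed
  have l: "int (Max (harmonic_cards (W i) (- X i))) = l i + 1" if i: "i \<in> ?I" for i
  proof -
    have "Leray_number (W i) (X i) = int (Max (harmonic_cards (W i) (- X i))) - 1"
    proof (rule Leray_number_eq_subset[OF WV[OF i]])
      fix A B assume "A \<in> X i" "B \<subseteq> A"
      then show "B \<in> X i" by (rule down[OF i])
    next
      show "W i \<notin> X i" using WX[OF i] by simp
    qed
    then show ?thesis using assms(5)[OF i] by (simp add: W_def X_def)
  qed
  have "Leray_number (pverts H) (I_complex ?T (with_proj H)) =
      int (Max (harmonic_cards (pverts H) (- I_complex ?T (with_proj H)))) - 1"
  proof (rule Leray_number_eq_subset)
    fix A B assume "A \<in> I_complex ?T (with_proj H)" "B \<subseteq> A"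
    with finH show "B \<in> I_complex ?T (with_proj H)"
      by - (rule I_complex_subset[of "with_proj H" A], simp_all)
  next
    show "pverts H \<notin> I_complex ?T (with_proj H)"
      using independence_number_induce_verts[of "with_proj H"] unfolding first I_complex_def by simp
  qed (simp add: vs)
  also have "harmonic_cards (pverts H) (- I_complex ?T (with_proj H)) =
      harmonic_cards (\<Union>i\<in>?I. W i) {A. \<forall>i\<in>?I. A \<inter> W i \<in> - X i}"
    unfolding pH(1)[symmetric] using nonface by (rule harmonic_cards_cong)
  also have "Max \<dots> = (\<Sum>i\<in>?I. Max (harmonic_cards (W i) (- X i)))"
    using assms(2) WV WX by (intro Max_harmonic_cards_Union) (auto simp: W_def)
  \<comment> \<open>Each of the \<open>m\<close> maxima equals \<open>l i + 1\<close>.\<close>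
  also have "int \<dots> = (\<Sum>i\<in>?I. l i) + int m"
    using l by (simp add: sum.distrib)
  finally show ?thesis using first by blast
qed

end
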